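(* Let $\Omega\subset\mathbb{R}^2$ be a bounded, simply connected open set containing the origin $O$ and let $\boldsymbol{E}\in\mathcal{A}(\Omega,\mathrm{Sym})$ be a singular strain field. Write $\boldsymbol{E}_0=\boldsymbol{E}|_{\Omega-O}$ (a smooth map on $\Omega-O$). Consider the conditions (i) $\operatorname{curl}\operatorname{curl}\boldsymbol{E}_0=0$ on $\Omega-O$; (ii) for all $\boldsymbol{x}\in\Omega-O$, $$\int_{\partial B_\epsilon}\Big\{\boldsymbol{E}_0(\boldsymbol{y})\,d\boldsymbol{y}+\big((\boldsymbol{y}-\boldsymbol{x})\times\boldsymbol{e}_3\big)\,\langle\operatorname{curl}\boldsymbol{E}_0(\boldsymbol{y}),d\boldsymbol{y}\rangle\Big\}=\boldsymbol{0},$$ where $B_\epsilon$ is any open disc of radius $\epsilon>0$ centred at $O$ with $\overline{B_\epsilon}\subset\Omega$. Then: (a) The compatibility condition $\operatorname{Curl}\operatorname{Curl}\boldsymbol{E}=0$ (in the sense of distributions on $\Omega$) implies (i) and (ii). (b) If $\deg(\boldsymbol{E})<-2$, then $\operatorname{Curl}\operatorname{Curl}\boldsymbol{E}=0$ is equivalent to (i). (c) If $-2\le\deg(\boldsymbol{E})<0$, then $\operatorname{Curl}\operatorname{Curl}\boldsymbol{E}=0$ is equivalent to (i) and (ii) together.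
   Context: $\Omega-O$ means $\Omega\setminus\{O\}$; $\mathrm{Sym}$ is the space of symmetric linear maps $\mathbb{R}^2\to\mathbb{R}^2$. $\mathcal{A}(\Omega,\mathrm{Sym})$ is the set of $\mathrm{Sym}$-valued distributions on $\Omega$ whose singular support is contained in $\{O\}$; their restriction to $\Omega-O$ is given by a smooth function and is identified with it. For a vector distribution, $\operatorname{Curl}\boldsymbol{v}=\partial_1v_2-\partial_2v_1$ (a scalar); for a tensor distribution, $\operatorname{Curl}\boldsymbol{V}$ is the vector defined by $\langle\operatorname{Curl}\boldsymbol{V},\boldsymbol{a}\rangle=\operatorname{Curl}(\boldsymbol{V}^T\boldsymbol{a})$ for fixed $\boldsymbol{a}\in\mathbb{R}^2$, i.e. $(\operatorname{Curl}\boldsymbol{V})_i=\partial_1V_{i2}-\partial_2V_{i1}$. Thus $\operatorname{Curl}\operatorname{Curl}\boldsymbol{E}=\partial_1\partial_1E_{22}-2\partial_1\partial_2E_{12}+\partial_2\partial_2E_{11}$. $\operatorname{curl}$ denotes the same operators applied classically to smooth functions. For $\boldsymbol{v}\in\mathbb{R}^2$, $\boldsymbol{v}\times\boldsymbol{e}_3=v_2\boldsymbol{e}_1-v_1\boldsymbol{e}_2$. The line integral is over the circle $\partial B_\epsilon$ traversed counterclockwise, $d\boldsymbol{y}$ being the vector line element and $\boldsymbol{E}_0(\boldsymbol{y})\,d\boldsymbol{y}$ the matrix applied to it. Degree of divergence (with respect to $O$): choose an open ball $B_r\subset\Omega$ centred at $O$. For a test function $\phi$ on $B_r$ and $0<\lambda<1$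 put $\phi_\lambda(\boldsymbol{x})=\lambda^{-2}\phi(\boldsymbol{x}/\lambda)$ and $(T|_{B_r})_\lambda(\phi)=T(\phi_\lambda)$. The scaling degree is $\operatorname{sd}(T)=\inf\{k\in\mathbb{R}:\lim_{\lambda\to0}\lambda^k(T|_{B_r})_\lambda=0 \text{ in the sense of distributions}\}$ and $\deg(T)=\operatorname{sd}(T)-2$. For tensor valued distributions the same definition is used with tensor valued test functions (equivalently, the maximum over components). *)

theory Defs
  imports "HOL-Analysis.Analysis"
begin

definition pd :: "2 \<Rightarrow> (real^2 \<Rightarrow> 'v::euclidean_space) \<Rightarrow> real^2 \<Rightarrow> 'v" where
  "pd i f x = frechet_derivative f (at x) (axis i 1)"

definition pds :: "2 list \<Rightarrow> (real^2 \<Rightarrow> 'v::euclidean_space) \<Rightarrow> real^2 \<Rightarrow> 'v" where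
  "pds is f = foldr pd is f"

text \<open>Intended for open \<open>S\<close>. Differentiability of every iterated partial derivative makes all of them
  continuous, so this is \<open>C\<^sup>\<infinity>\<close>.\<close>

definition smooth_on :: "(real^2) set \<Rightarrow> (real^2 \<Rightarrow> 'v::euclidean_space) \<Rightarrow> bool" where
  "smooth_on S f \<longleftrightarrow> (\<forall>is. \<forall>x\<in>S. pds is f differentiable (at x))"

definition supp :: "(real^2 \<Rightarrow> 'v::euclidean_space) \<Rightarrow> (real^2) set" where
  "supp f = closure {x. f x \<noteq> 0}"

definition test_functions :: "(real^2) set \<Rightarrow> (real^2 \<Rightarrow> 'v::euclidean_space) set" where
  "test_functions U = {\<phi>. smooth_on UNIV \<phi> \<and> compact (supp \<phi>) \<and> supp \<phi> \<subseteq> U}"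

text \<open>A \<open>'v\<close>-valued distribution on \<open>U\<close> is a continuous linear functional on the \<open>'v\<close>-valued test
  functions on \<open>U\<close>; its values on other arguments are irrelevant. Scalar, vector and tensor
  distributions are the cases \<open>real\<close>, \<open>real^2\<close> and \<open>real^2^2\<close>. Since the values elsewhere do not
  matter, the restriction to an open subset is the same functional.\<close>

definition distribution_on ::
    "(real^2) set \<Rightarrow> ((real^2 \<Rightarrow> 'v::euclidean_space) \<Rightarrow> real) \<Rightarrow> bool" where
  "distribution_on U T \<longleftrightarrow>
    (\<forall>\<phi>\<in>test_functions U. \<forall>\<psi>\<in>test_functions U. \<forall>a b.
        T (\<lambda>x. a *\<^sub>R \<phi> x + b *\<^sub>R \<psi> x) = a * T \<phi> + b * T \<psi>) \<and>
    (\<forall>K. compact K \<and> K \<subseteq> U \<longrightarrow>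
      (\<exists>C N. \<forall>\<phi>\<in>test_functions U. supp \<phi> \<subseteq> K \<longrightarrow>
        \<bar>T \<phi>\<bar> \<le> C * (\<Sum>is | length is \<le> N. SUP x. norm (pds is \<phi> x))))"

definition given_by ::
    "(real^2) set \<Rightarrow> ((real^2 \<Rightarrow> 'v::euclidean_space) \<Rightarrow> real) \<Rightarrow> (real^2 \<Rightarrow> 'v) \<Rightarrow> bool" where
  "given_by U T f \<longleftrightarrow> (\<forall>\<phi>\<in>test_functions U. T \<phi> = (LINT x:U|lborel. f x \<bullet> \<phi> x))"

definition sing_supp ::
    "(real^2) set \<Rightarrow> ((real^2 \<Rightarrow> 'v::euclidean_space) \<Rightarrow> real) \<Rightarrow> (real^2) set" where
  "sing_supp \<Omega> T =
    {x\<in>\<Omega>. \<not> (\<exists>U f. open U \<and> x \<in> U \<and> U \<subseteq> \<Omega> \<and> smooth_on U f \<and> given_by U T f)}"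

text \<open>Symmetry \<open>V = V\<^sup>T\<close> of a tensor distribution, by duality: \<open>V\<^sup>T \<Phi> = V \<Phi>\<^sup>T\<close>. In terms of the
  components \<open>V\<^sub>i\<^sub>j \<phi> = V (\<phi> e\<^sub>i \<otimes> e\<^sub>j)\<close> it says \<open>V\<^sub>1\<^sub>2 = V\<^sub>2\<^sub>1\<close>.\<close>

definition sym_valued :: "(real^2) set \<Rightarrow> ((real^2 \<Rightarrow> real^2^2) \<Rightarrow> real) \<Rightarrow> bool" where
  "sym_valued U V \<longleftrightarrow> (\<forall>\<Phi>\<in>test_functions U. V (\<lambda>x. transpose (\<Phi> x)) = V \<Phi>)"

definition singular_sym_fields :: "(real^2) set \<Rightarrow> ((real^2 \<Rightarrow> real^2^2) \<Rightarrow> real) set" where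
  "singular_sym_fields \<Omega> = {E. distribution_on \<Omega> E \<and> sym_valued \<Omega> E \<and> sing_supp \<Omega> E \<subseteq> {0}}"

definition dist_pd :: "2 \<Rightarrow> ((real^2 \<Rightarrow> real) \<Rightarrow> real) \<Rightarrow> (real^2 \<Rightarrow> real) \<Rightarrow> real" where
  "dist_pd i T \<phi> = - T (pd i \<phi>)"

definition dist_comp :: "2 \<Rightarrow> ((real^2 \<Rightarrow> real^2) \<Rightarrow> real) \<Rightarrow> (real^2 \<Rightarrow> real) \<Rightarrow> real" where
  "dist_comp i v \<phi> = v (\<lambda>x. axis i (\<phi> x))"

definition Curl_vec :: "((real^2 \<Rightarrow> real^2) \<Rightarrow> real) \<Rightarrow> (real^2 \<Rightarrow> real) \<Rightarrow> real" where
  "Curl_vec v \<phi> = dist_pd 1 (dist_comp 2 v) \<phi> - dist_pd 2 (dist_comp 1 v) \<phi>"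

text \<open>The vector distribution \<open>V\<^sup>T a\<close>: since \<open>V\<^sup>T a \<cdot> w = V \<cdot> (a \<otimes> w)\<close>, it maps \<open>\<psi>\<close> to
  \<open>V (a \<otimes> \<psi>)\<close>.\<close>

definition dist_transpose_apply ::
    "((real^2 \<Rightarrow> real^2^2) \<Rightarrow> real) \<Rightarrow> real^2 \<Rightarrow> (real^2 \<Rightarrow> real^2) \<Rightarrow> real" where
  "dist_transpose_apply V a \<psi> = V (\<lambda>x. \<chi> i j. a $ i * \<psi> x $ j)"

text \<open>\<open>Curl V\<close> is determined by \<open>\<langle>Curl V, a\<rangle> = Curl (V\<^sup>T a)\<close>; here \<open>a\<close> runs through the standard
  basis, which gives the components of \<open>Curl V\<close>.\<close>

definition Curl_tensor :: "((real^2 \<Rightarrow> real^2^2) \<Rightarrow> real) \<Rightarrow> (real^2 \<Rightarrow> real^2) \<Rightarrow> real" where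
  "Curl_tensor V \<psi> =
    (\<Sum>i\<in>UNIV. Curl_vec (dist_transpose_apply V (axis i 1)) (\<lambda>x. \<psi> x $ i))"

definition curl_vec :: "(real^2 \<Rightarrow> real^2) \<Rightarrow> real^2 \<Rightarrow> real" where
  "curl_vec v x = pd 1 (\<lambda>y. v y $ 2) x - pd 2 (\<lambda>y. v y $ 1) x"

definition curl_tensor :: "(real^2 \<Rightarrow> real^2^2) \<Rightarrow> real^2 \<Rightarrow> real^2" where
  "curl_tensor V x = (\<chi> i. curl_vec (\<lambda>y. transpose (V y) *v axis i 1) x)"

definition cross_e3 :: "real^2 \<Rightarrow> real^2" where
  "cross_e3 v = vector [v $ 2, - v $ 1]"

text \<open>The circle of radius \<open>\<epsilon>\<close> about the origin is parametrised counterclockwise by \<open>y\<close>, and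
  \<open>dy\<close> is its derivative.\<close>

definition circle_integral :: "(real^2 \<Rightarrow> real^2^2) \<Rightarrow> real \<Rightarrow> real^2 \<Rightarrow> real^2" where
  "circle_integral E0 \<epsilon> x =
    integral {0..2 * pi} (\<lambda>t.
      let y = vector [\<epsilon> * cos t, \<epsilon> * sin t];
          dy = vector [- \<epsilon> * sin t, \<epsilon> * cos t]
      in E0 y *v dy + (curl_tensor E0 y \<bullet> dy) *\<^sub>R cross_e3 (y - x))"

definition rescale :: "real \<Rightarrow> (real^2 \<Rightarrow> 'v::euclidean_space) \<Rightarrow> real^2 \<Rightarrow> 'v" where
  "rescale l \<phi> x = (1 / l\<^sup>2) *\<^sub>R \<phi> ((1 / l) *\<^sub>R x)"

text \<open>Both notions are taken with respect to the origin and the ball of radius \<open>r\<close>; the values are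
  extended reals because the infimum is \<open>-\<infinity>\<close>, for example, when \<open>T\<close> vanishes near the origin.\<close>

definition scaling_degree :: "real \<Rightarrow> ((real^2 \<Rightarrow> 'v::euclidean_space) \<Rightarrow> real) \<Rightarrow> ereal" where
  "scaling_degree r T =
    Inf {ereal k | k. \<forall>\<phi>\<in>test_functions (ball 0 r).
      ((\<lambda>l. l powr k * T (rescale l \<phi>)) \<longlongrightarrow> 0) (at_right 0)}"

definition degree_of_divergence :: "real \<Rightarrow> ((real^2 \<Rightarrow> 'v::euclidean_space) \<Rightarrow> real) \<Rightarrow> ereal" where
  "degree_of_divergence r T = scaling_degree r T - 2"

end

theory Submission
  imports Defs
begin

text \<open>
  Write \<open>T = Curl Curl E\<close>, so that \<open>T \<phi> = E (airy \<phi>)\<close>, where \<open>airy \<phi>\<close> is the rotated Hessian of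
  \<open>\<phi>\<close> (the stress tensor with Airy function \<open>\<phi>\<close>).

  Away from the origin \<open>E\<close> is the smooth field \<open>E\<^sub>0\<close>, and two integrations by parts show that there
  \<open>T\<close> is the function \<open>curl curl E\<^sub>0\<close> (\<open>integral_airy\<close>). By the fundamental lemma of the calculus of
  variations, condition (i) says that \<open>T\<close> is supported at the origin.

  Assume this. For an affine function \<open>a\<close> and a radial cutoff \<open>\<eta>\<close> that is 1 near the origin,
  \<open>airy (\<eta> a)\<close> vanishes near the origin, so that \<open>T (\<eta> a)\<close> is an integral of \<open>E\<^sub>0\<close> over an
  annulus. It equals the integral of \<open>V \<times> \<nabla>\<eta>\<close> up to sign, where the field \<open>V\<close> (\<open>moment_field\<close>) is
  built from \<open>E\<^sub>0\<close>, \<open>curl E\<^sub>0\<close> and \<open>a\<close> and is curl-free by (i). The circulation of \<open>V\<close> is the same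
  along all circles about the origin, and since \<open>\<nabla>\<eta>\<close> is radial, an average over rotations gives
  \<open>T (\<eta> a)\<close> as a nonzero constant times this circulation (\<open>integral_cutoff_circulation\<close>). The
  components of the line integral in (ii) are these circulations for \<open>a(y) = x\<^sub>2 - y\<^sub>2\<close> and
  \<open>a(y) = y\<^sub>1 - x\<^sub>1\<close>. Hence \<open>T = 0\<close> implies (ii), and conversely (ii) implies \<open>T (\<eta> a) = 0\<close> for
  all affine \<open>a\<close>, because these functions span the affine functions as \<open>x\<close> varies.

  It remains to exclude delta distributions and their derivatives in \<open>T\<close> by scaling. The scaling
  degree of \<open>T\<close> is at most that of \<open>E\<close> plus 2, while a derivative of order \<open>m\<close> of the delta
  distribution has scaling degree \<open>m + 2\<close>. If the degree of \<open>E\<close> is less than \<open>- 2\<close>, this leaves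
  \<open>T = 0\<close>; if it is negative, only \<open>m \<le> 1\<close> is possible, and then \<open>T\<close> is determined by its values on
  the functions \<open>\<eta> a\<close>. The precise form of this argument is \<open>point_supported_scaling\<close>. It rests on the
  fact that \<open>T\<close> annihilates every test function that vanishes to a sufficiently high order at the
  origin (\<open>point_supported_finite_order\<close>), and lowers this order step by step: if \<open>\<phi>\<close> vanishes to
  order \<open>m\<close>, then \<open>l\<^sup>m \<phi>(x / l)\<close> and \<open>\<phi>\<close> have the same derivatives up to order \<open>m\<close> at the origin.
\<close>

section \<open>Smooth functions on the plane\<close>

lemma pd_eqI: "(f has_derivative D) (at x) \<Longrightarrow> pd i f x = D (axis i 1)"
  unfolding pd_def by (metis frechet_derivative_at)

lemma pd_cong_open:
  assumes "open S" "x \<in> S" "\<And>y. y \<in> S \<Longrightarrow> f y = g y"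
  shows "pd i f x = pd i g x"
proof -
  have "(f has_derivative D) (at x) \<longleftrightarrow> (g has_derivative D) (at x)" for D
    using has_derivative_transform_within_open[of f D x UNIV S g]
      has_derivative_transform_within_open[of g D x UNIV S f] assms by auto
  then show ?thesis by (simp add: pd_def frechet_derivative_def)
qed

lemma differentiable_cong_open:
  assumes "open S" "x \<in> S" "\<And>y. y \<in> S \<Longrightarrow> f y = g y" "f differentiable (at x)"
  shows "g differentiable (at x)"
  using assms unfolding differentiable_def by (metis has_derivative_transform_within_open)

lemma pds_Nil [simp]: "pds [] f = f" and pds_Cons [simp]: "pds (i # is) f = pd i (pds is f)"
  by (simp_all add: pds_def fun_eq_iff)

lemma pds_append: "pds (is @ js) f = pds is (pds js f)"
  by (induction "is") auto

lemma pds_cong_open: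
  assumes "open S" "\<And>y. y \<in> S \<Longrightarrow> f y = g y" "x \<in> S"
  shows "pds is f x = pds is g x"
  using assms(3)
proof (induction "is" arbitrary: x)
  case (Cons i "is")
  then show ?case using assms(1) by (auto intro!: pd_cong_open[of S])
qed (use assms in auto)

lemma smooth_on_cong:
  assumes "open S" "\<And>y. y \<in> S \<Longrightarrow> f y = g y" "smooth_on S f"
  shows "smooth_on S g"
  unfolding smooth_on_def
proof (intro allI ballI)
  fix "is" x assume x: "x \<in> S"
  show "pds is g differentiable at x"
    by (rule differentiable_cong_open[OF assms(1) x, of "pds is f"])
      (use assms pds_cong_open[of S f g] x in \<open>auto simp: smooth_on_def\<close>)
qed

lemma smooth_on_subset: "smooth_on S f \<Longrightarrow> T \<subseteq> S \<Longrightarrow> smooth_on T f"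
  by (auto simp: smooth_on_def)

lemma smooth_on_Un: "smooth_on S f \<Longrightarrow> smooth_on T f \<Longrightarrow> smooth_on (S \<union> T) f"
  by (auto simp: smooth_on_def)

lemma smooth_on_pds: "smooth_on S f \<Longrightarrow> smooth_on S (pds is f)"
  unfolding smooth_on_def by (metis pds_append)

lemma smooth_on_pd: "smooth_on S f \<Longrightarrow> smooth_on S (pd i f)"
  using smooth_on_pds[of S f "[i]"] by simp

lemma smooth_on_differentiable: "smooth_on S f \<Longrightarrow> x \<in> S \<Longrightarrow> f differentiable (at x)"
  unfolding smooth_on_def by (metis pds_Nil)

lemma smooth_on_continuous_on: "smooth_on S f \<Longrightarrow> continuous_on S f"
  by (meson continuous_at_imp_continuous_on differentiable_imp_continuous_within
      smooth_on_differentiable)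

lemma smooth_on_has_derivative:
  assumes "smooth_on S f" "x \<in> S"
  shows "(f has_derivative (\<lambda>h. \<Sum>i\<in>UNIV. (h $ i) *\<^sub>R pd i f x)) (at x)"
proof -
  obtain D where D: "(f has_derivative D) (at x)"
    using smooth_on_differentiable[OF assms] by (auto simp: differentiable_def)
  then have lin: "linear D" by (rule has_derivative_linear)
  have "D h = (\<Sum>i\<in>UNIV. (h $ i) *\<^sub>R pd i f x)" for h
  proof -
    have "D h = D (\<Sum>i\<in>UNIV. (h $ i) *\<^sub>R axis i 1)"
      using basis_expansion[of h] by (simp add: scalar_mult_eq_scaleR)
    then show ?thesis
      using D lin by (simp add: linear_sum linear_scale pd_eqI)
  qed
  then have "D = (\<lambda>h. \<Sum>i\<in>UNIV. (h $ i) *\<^sub>R pd i f x)" by (rule ext)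
  then show ?thesis using D by simp
qed

text \<open>Products and compositions are smooth because their first partial derivatives are sums of products
  and compositions of the same kind. The induction therefore has to peel off the innermost
  derivative, whereas \<^const>\<open>pds\<close> recurses on the outermost one.\<close>

primrec diff_upto :: "nat \<Rightarrow> (real^2) set \<Rightarrow> (real^2 \<Rightarrow> 'v::euclidean_space) \<Rightarrow> bool" where
  "diff_upto 0 S f \<longleftrightarrow> (\<forall>x\<in>S. f differentiable (at x))"
| "diff_upto (Suc n) S f \<longleftrightarrow> (\<forall>x\<in>S. f differentiable (at x)) \<and> (\<forall>i. diff_upto n S (pd i f))"

lemma diff_upto_iff:
  "diff_upto n S f \<longleftrightarrow> (\<forall>is. length is \<le> n \<longrightarrow> (\<forall>x\<in>S. pds is f differentiable (at x)))"
proof (induction n arbitrary: f)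
  case (Suc n)
  show ?case
  proof safe
    fix js :: "2 list" and x
    assume a: "diff_upto (Suc n) S f" "length js \<le> Suc n" "x \<in> S"
    show "pds js f differentiable (at x)"
    proof (cases js rule: rev_cases)
      case Nil
      then show ?thesis using a by simp
    next
      case (snoc "is" i)
      then show ?thesis using a Suc[of "pd i f"] by (simp add: pds_append)
    qed
  next
    assume a: "\<forall>is. length is \<le> Suc n \<longrightarrow> (\<forall>x\<in>S. pds is f differentiable (at x))"
    have "diff_upto n S (pd i f)" for i
      unfolding Suc
    proof (intro allI impI)
      fix "is" :: "2 list" assume "length is \<le> n"
      then show "\<forall>x\<in>S. pds is (pd i f) differentiable (at x)"
        using a[rule_format, of "is @ [i]"] by (simp add: pds_append)
    qed
    moreover have "\<forall>x\<in>S. f differentiable (at x)" using a[rule_format, of "[]"] by simp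
    ultimately show "diff_upto (Suc n) S f" by simp
  qed
qed auto

lemma smooth_on_iff_diff_upto: "smooth_on S f \<longleftrightarrow> (\<forall>n. diff_upto n S f)"
  unfolding smooth_on_def diff_upto_iff by blast

lemma diff_upto_cong:
  assumes "open S" "\<And>y. y \<in> S \<Longrightarrow> f y = g y" "diff_upto n S f"
  shows "diff_upto n S g"
  unfolding diff_upto_iff
proof (intro allI impI ballI)
  fix "is" :: "2 list" and x assume "length is \<le> n" and x: "x \<in> S"
  then have "pds is f differentiable at x" using assms(3) by (auto simp: diff_upto_iff)
  then show "pds is g differentiable at x"
    by (rule differentiable_cong_open[OF assms(1) x, rotated])
      (use assms pds_cong_open[of S f g] in auto)
qed

lemma diff_upto_mono: "diff_upto (Suc n) S f \<Longrightarrow> diff_upto n S f"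
  by (auto simp: diff_upto_iff)

lemma pd_add:
  "f differentiable (at x) \<Longrightarrow> g differentiable (at x) \<Longrightarrow> pd i (\<lambda>x. f x + g x) x = pd i f x + pd i g x"
  unfolding frechet_derivative_works
  using pd_eqI[OF has_derivative_add] by (fastforce simp: pd_def)

lemma pd_linear:
  assumes "bounded_linear L" "f differentiable (at x)"
  shows "pd i (\<lambda>x. L (f x)) x = L (pd i f x)"
  using pd_eqI[OF bounded_linear.has_derivative[OF assms(1) assms(2)[unfolded frechet_derivative_works]], of i]
  by (simp add: pd_def)

lemma pd_bilinear:
  assumes "bounded_bilinear B" "f differentiable (at x)" "g differentiable (at x)"
  shows "pd i (\<lambda>x. B (f x) (g x)) x = B (f x) (pd i g x) + B (pd i f x) (g x)"
  using pd_eqI[OF bounded_bilinear.FDERIV[OF assms(1) assms(2,3)[unfolded frechet_derivative_works]], of i]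
  by (simp add: pd_def)

lemma differentiable_bilinear:
  assumes "bounded_bilinear B" "f differentiable (at x)" "g differentiable (at x)"
  shows "(\<lambda>x. B (f x) (g x)) differentiable (at x)"
  using bounded_bilinear.FDERIV[OF assms(1), of f _ x UNIV g] assms(2,3)
  unfolding differentiable_def by blast

lemma differentiable_linear:
  assumes "bounded_linear L" "f differentiable (at x)"
  shows "(\<lambda>x. L (f x)) differentiable (at x)"
  using assms unfolding differentiable_def by (metis bounded_linear.has_derivative)

lemma diff_upto_add:
  assumes "open S" "diff_upto n S f" "diff_upto n S g"
  shows "diff_upto n S (\<lambda>x. f x + g x)"
  using assms(2,3)
proof (induction n arbitrary: f g)
  case (Suc n)
  have "diff_upto n S (pd i (\<lambda>x. f x + g x))" for i
    by (rule diff_upto_cong[OF assms(1) _ Suc.IH[of "pd i f" "pd i g"]])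
      (use Suc.prems in \<open>auto simp: pd_add\<close>)
  then show ?case using Suc.prems by auto
qed auto

lemma diff_upto_linear:
  assumes "open S" "bounded_linear L" "diff_upto n S f"
  shows "diff_upto n S (\<lambda>x. L (f x))"
  using assms(3)
proof (induction n arbitrary: f)
  case 0
  then show ?case by (auto intro: differentiable_linear[OF assms(2)])
next
  case (Suc n)
  have "diff_upto n S (pd i (\<lambda>x. L (f x)))" for i
    by (rule diff_upto_cong[OF assms(1) _ Suc.IH[of "pd i f"]])
      (use Suc.prems assms in \<open>auto simp: pd_linear\<close>)
  then show ?case using Suc.prems by (auto intro: differentiable_linear[OF assms(2)])
qed

lemma diff_upto_bilinear:
  assumes "open S" "bounded_bilinear B" "diff_upto n S f" "diff_upto n S g"
  shows "diff_upto n S (\<lambda>x. B (f x) (g x))"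
  using assms(3,4)
proof (induction n arbitrary: f g)
  case 0
  then show ?case by (auto intro: differentiable_bilinear[OF assms(2)])
next
  case (Suc n)
  have "diff_upto n S (pd i (\<lambda>x. B (f x) (g x)))" for i
  proof (rule diff_upto_cong[OF assms(1)])
    show "diff_upto n S (\<lambda>x. B (f x) (pd i g x) + B (pd i f x) (g x))"
      by (intro diff_upto_add Suc.IH assms) (use Suc.prems diff_upto_mono in auto)
  qed (use Suc.prems assms in \<open>auto simp: pd_bilinear\<close>)
  then show ?case using Suc.prems by (auto intro: differentiable_bilinear[OF assms(2)])
qed

lemma smooth_on_add:
  "open S \<Longrightarrow> smooth_on S f \<Longrightarrow> smooth_on S g \<Longrightarrow> smooth_on S (\<lambda>x. f x + g x)"
  by (auto simp: smooth_on_iff_diff_upto intro: diff_upto_add)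

lemma smooth_on_linear:
  "open S \<Longrightarrow> bounded_linear L \<Longrightarrow> smooth_on S f \<Longrightarrow> smooth_on S (\<lambda>x. L (f x))"
  by (auto simp: smooth_on_iff_diff_upto intro: diff_upto_linear)

lemma smooth_on_bilinear:
  "open S \<Longrightarrow> bounded_bilinear B \<Longrightarrow> smooth_on S f \<Longrightarrow> smooth_on S g
    \<Longrightarrow> smooth_on S (\<lambda>x. B (f x) (g x))"
  by (auto simp: smooth_on_iff_diff_upto intro: diff_upto_bilinear)

lemma smooth_on_mult:
  fixes f g :: "real^2 \<Rightarrow> real"
  shows "open S \<Longrightarrow> smooth_on S f \<Longrightarrow> smooth_on S g \<Longrightarrow> smooth_on S (\<lambda>x. f x * g x)"
  by (rule smooth_on_bilinear[OF _ bounded_bilinear_mult])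

lemma smooth_on_minus: "open S \<Longrightarrow> smooth_on S f \<Longrightarrow> smooth_on S (\<lambda>x. - f x)"
  by (rule smooth_on_linear[OF _ bounded_linear_minus[OF bounded_linear_ident]])

lemma smooth_on_diff:
  "open S \<Longrightarrow> smooth_on S f \<Longrightarrow> smooth_on S g \<Longrightarrow> smooth_on S (\<lambda>x. f x - g x)"
  using smooth_on_add[of S f "\<lambda>x. - g x"] smooth_on_minus[of S g] by simp

lemma pd_const [simp]: "pd i (\<lambda>x. c) = (\<lambda>x. 0)"
  by (auto simp: fun_eq_iff intro!: pd_eqI[THEN trans])

lemma pds_const: "pds is (\<lambda>x. c) = (if is = [] then \<lambda>x. c else (\<lambda>x. 0))"
  by (induction "is") auto

lemma smooth_on_const: "smooth_on S (\<lambda>x. c)"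
  by (auto simp: smooth_on_def pds_const)

lemma smooth_on_vec_linear:
  assumes "bounded_linear L"
  shows "smooth_on S L"
proof -
  have "pd i L = (\<lambda>x. L (axis i 1))" for i
    using bounded_linear_imp_has_derivative[OF assms] by (auto simp: fun_eq_iff intro!: pd_eqI)
  then have "smooth_on UNIV L"
    unfolding smooth_on_iff_diff_upto
    using assms smooth_on_const[of UNIV]
    by (intro allI, case_tac n) (auto simp: smooth_on_iff_diff_upto bounded_linear_imp_differentiable)
  then show ?thesis by (rule smooth_on_subset) auto
qed

lemma has_derivative_compose_real:
  fixes f :: "real \<Rightarrow> real"
  assumes "(f has_real_derivative d) (at (u x))" "(u has_derivative D) (at x)"
  shows "((\<lambda>x. f (u x)) has_derivative (\<lambda>h. d * D h)) (at x)"
  using has_derivative_compose[OF assms(2) assms(1)[unfolded has_field_derivative_def]] by simp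

lemma pd_compose_real:
  assumes "\<And>n t. (F n has_real_derivative F (Suc n) t) (at t)" "u differentiable (at x)"
  shows "pd i (\<lambda>x. F k (u x)) x = F (Suc k) (u x) * pd i u x"
  using assms(2) has_derivative_compose_real[OF assms(1), of u _ x k]
  by (metis differentiable_def pd_eqI)

lemma differentiable_compose_real:
  assumes "\<And>n t. (F n has_real_derivative F (Suc n) t) (at t)" "u differentiable (at x)"
  shows "(\<lambda>x. F k (u x)) differentiable (at x)"
  using assms(2) has_derivative_compose_real[OF assms(1), of u _ x k]
  by (metis differentiable_def)

text \<open>The sequence \<open>F\<close> lists the successive derivatives of the outer function.\<close>

lemma diff_upto_compose:
  fixes F :: "nat \<Rightarrow> real \<Rightarrow> real" and u :: "real^2 \<Rightarrow> real"
  assumes S: "open S" and F: "\<And>n t. (F n has_real_derivative F (Suc n) t) (at t)"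
    and u: "smooth_on S u"
  shows "diff_upto n S (\<lambda>x. F k (u x))"
proof -
  note pd_chain = pd_compose_real[where F = F, OF F smooth_on_differentiable[OF u]]
  note differentiable_chain = differentiable_compose_real[where F = F, OF F smooth_on_differentiable[OF u]]
  show ?thesis
  proof (induction n arbitrary: k)
    case 0
    show ?case
      using differentiable_chain by auto
  next
    case (Suc n)
    have "diff_upto n S (pd i (\<lambda>x. F k (u x)))" for i
    proof (rule diff_upto_cong[OF S])
      have "diff_upto n S (pd i u)" using u smooth_on_pd smooth_on_iff_diff_upto by blast
      then show "diff_upto n S (\<lambda>x. F (Suc k) (u x) * pd i u x)"
        by (intro diff_upto_bilinear[OF S bounded_bilinear_mult] Suc.IH)
    qed (simp add: pd_chain)
    then show ?case using differentiable_chain by auto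
  qed
qed

lemma smooth_on_compose:
  fixes F :: "nat \<Rightarrow> real \<Rightarrow> real" and u :: "real^2 \<Rightarrow> real"
  assumes "open S" "\<And>n t. (F n has_real_derivative F (Suc n) t) (at t)" "smooth_on S u"
  shows "smooth_on S (\<lambda>x. F k (u x))"
  using diff_upto_compose[where F = F, OF assms] by (simp add: smooth_on_iff_diff_upto)

lemma pd_affine:
  fixes f :: "real^2 \<Rightarrow> 'v::euclidean_space"
  assumes "f differentiable (at (c *\<^sub>R x + d))"
  shows "pd i (\<lambda>x. f (c *\<^sub>R x + d)) x = c *\<^sub>R pd i f (c *\<^sub>R x + d)"
    and "(\<lambda>x. f (c *\<^sub>R x + d)) differentiable (at x)"
proof -
  obtain D where D: "(f has_derivative D) (at (c *\<^sub>R x + d))"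
    using assms by (auto simp: differentiable_def)
  have 1: "((\<lambda>x. f (c *\<^sub>R x + d)) has_derivative (\<lambda>h. D (c *\<^sub>R h))) (at x)"
    by (rule has_derivative_compose[where g = f and f = "\<lambda>x. c *\<^sub>R x + d", OF _ D]) (auto intro!: derivative_eq_intros)
  show "pd i (\<lambda>x. f (c *\<^sub>R x + d)) x = c *\<^sub>R pd i f (c *\<^sub>R x + d)"
    using pd_eqI[OF 1, of i] pd_eqI[OF D, of i] has_derivative_linear[OF D]
    by (simp add: linear_scale)
  show "(\<lambda>x. f (c *\<^sub>R x + d)) differentiable (at x)"
    using 1 by (auto simp: differentiable_def)
qed

lemma pds_affine:
  assumes "smooth_on UNIV f"
  shows "pds is (\<lambda>x. f (c *\<^sub>R x + d)) = (\<lambda>x. c ^ length is *\<^sub>R pds is f (c *\<^sub>R x + d))"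
proof (induction "is")
  case (Cons i "is")
  have diff: "pds is f differentiable (at y)" for y
    using assms by (auto simp: smooth_on_def)
  have "pd i (\<lambda>x. c ^ length is *\<^sub>R pds is f (c *\<^sub>R x + d)) x
      = c ^ length is *\<^sub>R (c *\<^sub>R pd i (pds is f) (c *\<^sub>R x + d))" for x
    using pd_linear[OF bounded_linear_scaleR_right pd_affine(2)[OF diff]] pd_affine(1)[OF diff]
    by metis
  then show ?case by (simp add: Cons fun_eq_iff mult.commute)
qed simp

lemma smooth_on_affine:
  assumes "smooth_on UNIV f"
  shows "smooth_on UNIV (\<lambda>x. f (c *\<^sub>R x + d))"
proof -
  have "(\<lambda>x. c ^ length is *\<^sub>R pds is f (c *\<^sub>R x + d)) differentiable (at x)" for "is" x
    using assms
    using differentiable_linear[OF bounded_linear_scaleR_right pd_affine(2)[of "pds is f"]]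
    by (auto simp: smooth_on_def)
  then show ?thesis by (simp add: smooth_on_def pds_affine[OF assms])
qed

lemma pds_add:
  assumes "smooth_on UNIV f" "smooth_on UNIV g"
  shows "pds is (\<lambda>x. f x + g x) = (\<lambda>x. pds is f x + pds is g x)"
proof (induction "is")
  case (Cons i "is")
  have "pd i (\<lambda>x. pds is f x + pds is g x) x = pd i (pds is f) x + pd i (pds is g) x" for x
    using assms by (intro pd_add) (auto simp: smooth_on_def)
  then show ?case by (simp add: Cons fun_eq_iff)
qed simp

lemma pds_linear:
  assumes "bounded_linear L" "smooth_on UNIV f"
  shows "pds is (\<lambda>x. L (f x)) = (\<lambda>x. L (pds is f x))"
proof (induction "is")
  case (Cons i "is")
  have "pd i (\<lambda>x. L (pds is f x)) x = L (pd i (pds is f) x)" for x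
    using assms by (intro pd_linear) (auto simp: smooth_on_def)
  then show ?case by (simp add: Cons fun_eq_iff)
qed simp

lemma pds_diff:
  assumes "smooth_on UNIV f" "smooth_on UNIV g"
  shows "pds is (\<lambda>x. f x - g x) = (\<lambda>x. pds is f x - pds is g x)"
proof -
  have neg: "bounded_linear (\<lambda>x::'a. - x)" by (rule bounded_linear_minus[OF bounded_linear_ident])
  show ?thesis
    using pds_add[OF assms(1) smooth_on_minus[OF open_UNIV assms(2)], of "is"] pds_linear[OF neg assms(2), of "is"]
    by simp
qed

section \<open>Test functions\<close>

lemma not_in_supp: "x \<notin> supp f \<Longrightarrow> f x = 0"
  using closure_subset[of "{x. f x \<noteq> 0}"] unfolding supp_def by auto

lemma closed_supp: "closed (supp f)"
  by (simp add: supp_def)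

lemma supp_subsetI: "closed K \<Longrightarrow> (\<And>x. x \<notin> K \<Longrightarrow> f x = 0) \<Longrightarrow> supp f \<subseteq> K"
  unfolding supp_def by (rule closure_minimal) auto

lemma pds_not_in_supp: "x \<notin> supp f \<Longrightarrow> pds is f x = 0"
  using pds_cong_open[of "- supp f" f "\<lambda>x. 0" x "is"] not_in_supp[of _ f]
  by (simp add: pds_const closed_supp open_Compl split: if_splits)

lemma test_functionsI:
  assumes "smooth_on UNIV f" "compact K" "K \<subseteq> U" "\<And>x. x \<notin> K \<Longrightarrow> f x = 0"
  shows "f \<in> test_functions U"
proof -
  have "supp f \<subseteq> K" using supp_subsetI[of K f] assms compact_imp_closed by blast
  then have "compact (supp f)"
    using compact_Int_closed[OF assms(2), of "supp f"] by (simp add: supp_def Int_absorb1)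
  with \<open>supp f \<subseteq> K\<close> show ?thesis using assms by (auto simp: test_functions_def)
qed

lemma test_functionsD:
  assumes "f \<in> test_functions U"
  shows "smooth_on UNIV f" "compact (supp f)" "supp f \<subseteq> U"
  using assms by (auto simp: test_functions_def)

lemma test_functions_mono: "f \<in> test_functions U \<Longrightarrow> U \<subseteq> V \<Longrightarrow> f \<in> test_functions V"
  by (auto simp: test_functions_def)

lemma test_functions_pd:
  assumes "f \<in> test_functions U"
  shows "pd i f \<in> test_functions U"
  using pds_not_in_supp[of _ f "[i]"]
  by (intro test_functionsI[of _ "supp f"]) (use test_functionsD[OF assms] smooth_on_pd in auto)

lemma test_functions_linear:
  assumes "bounded_linear L" "f \<in> test_functions U"
  shows "(\<lambda>x. L (f x)) \<in> test_functions U"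
  using linear_0[OF bounded_linear.linear[OF assms(1)]] not_in_supp[of _ f]
  by (intro test_functionsI[of _ "supp f"])
    (use test_functionsD[OF assms(2)] smooth_on_linear[OF open_UNIV assms(1)] in auto)

lemma test_functions_add:
  assumes "f \<in> test_functions U" "g \<in> test_functions U"
  shows "(\<lambda>x. f x + g x) \<in> test_functions U"
  using not_in_supp[of _ f] not_in_supp[of _ g]
  by (intro test_functionsI[of _ "supp f \<union> supp g"])
    (use test_functionsD[OF assms(1)] test_functionsD[OF assms(2)] smooth_on_add[of UNIV f g] in auto)

lemma test_functions_zero: "(\<lambda>x. 0) \<in> test_functions U"
  by (rule test_functionsI[of _ "{}"]) (auto intro: smooth_on_const)

text \<open>The second factor only has to be smooth where the test function lives; off the support the product
  is zero.\<close>

lemma test_functions_bilinear: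
  assumes "open U" "bounded_bilinear B" "f \<in> test_functions U" "smooth_on U g"
  shows "(\<lambda>x. B (f x) (g x)) \<in> test_functions U"
proof -
  note f = test_functionsD[OF assms(3)]
  have zero: "B (f x) (g x) = 0" if "x \<notin> supp f" for x
    using not_in_supp[OF that] bounded_bilinear.zero_left[OF assms(2)] by simp
  have "smooth_on U (\<lambda>x. B (f x) (g x))"
    using smooth_on_bilinear[OF assms(1,2) smooth_on_subset[OF f(1)] assms(4)] by simp
  moreover have "smooth_on (- supp f) (\<lambda>x. B (f x) (g x))"
    by (rule smooth_on_cong[OF _ _ smooth_on_const[of _ 0]])
      (use zero f(2) in \<open>auto dest: compact_imp_closed\<close>)
  ultimately have "smooth_on (U \<union> - supp f) (\<lambda>x. B (f x) (g x))" by (rule smooth_on_Un)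
  moreover have "U \<union> - supp f = UNIV" using f(3) by auto
  ultimately show ?thesis using zero f by (intro test_functionsI[of _ "supp f"]) auto
qed

lemma test_functions_mult:
  fixes f g :: "real^2 \<Rightarrow> real"
  shows "open U \<Longrightarrow> f \<in> test_functions U \<Longrightarrow> smooth_on U g \<Longrightarrow> (\<lambda>x. f x * g x) \<in> test_functions U"
  by (rule test_functions_bilinear[OF _ bounded_bilinear_mult])

lemma test_functions_diff:
  assumes "f \<in> test_functions U" "g \<in> test_functions U"
  shows "(\<lambda>x. f x - g x) \<in> test_functions U"
  using test_functions_add[OF assms(1) test_functions_linear[OF bounded_linear_minus[OF bounded_linear_ident] assms(2)]]
  by simp

lemma continuous_on_test_function: "f \<in> test_functions U \<Longrightarrow> continuous_on S f"
  using continuous_on_subset smooth_on_continuous_on test_functionsD(1) by blast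

lemma test_function_bounded:
  assumes "f \<in> test_functions U"
  shows "\<exists>C>0. \<forall>x. norm (f x) \<le> C"
proof -
  have "bounded (f ` supp f)"
    using assms continuous_on_test_function compact_continuous_image compact_imp_bounded
      test_functionsD(2) by metis
  then obtain C where "C > 0" "\<forall>x\<in>supp f. norm (f x) \<le> C" by (auto simp: bounded_pos)
  then show ?thesis using not_in_supp[of _ f] by (metis norm_zero less_imp_le)
qed

lemma test_functions_dilate:
  assumes f: "f \<in> test_functions (ball 0 r)" and l: "l > 0" "l \<le> 1"
  shows "(\<lambda>x. f ((1 / l) *\<^sub>R x)) \<in> test_functions (ball 0 r)"
proof (rule test_functionsI)
  show "smooth_on UNIV (\<lambda>x. f ((1 / l) *\<^sub>R x))"
    using smooth_on_affine[OF test_functionsD(1)[OF f], of "1 / l" 0] by simp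
  show "compact ((\<lambda>x. l *\<^sub>R x) ` supp f)"
    using test_functionsD(2)[OF f] by (rule compact_scaling)
  have "norm (l *\<^sub>R x) < r" if "x \<in> supp f" for x
  proof -
    have "norm x < r" using test_functionsD(3)[OF f] that by auto
    moreover have "norm (l *\<^sub>R x) \<le> norm x" using l by (simp add: mult_left_le_one_le)
    ultimately show ?thesis by linarith
  qed
  then show "(\<lambda>x. l *\<^sub>R x) ` supp f \<subseteq> ball 0 r" by auto
  show "f ((1 / l) *\<^sub>R x) = 0" if "x \<notin> (\<lambda>x. l *\<^sub>R x) ` supp f" for x
  proof (rule not_in_supp, rule notI)
    assume "(1 / l) *\<^sub>R x \<in> supp f"
    then have "l *\<^sub>R ((1 / l) *\<^sub>R x) \<in> (\<lambda>x. l *\<^sub>R x) ` supp f" by (rule imageI)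
    then show False using that l by simp
  qed
qed

section \<open>A radial cutoff function\<close>

text \<open>The classical flat functions \<open>p(1/t) exp(-1/t)\<close> are closed under differentiation, so all of them
  are smooth.\<close>

definition flat :: "real poly \<Rightarrow> real \<Rightarrow> real" where
  "flat p t = (if t > 0 then poly p (1 / t) * exp (- 1 / t) else 0)"

definition flat_step :: "real poly \<Rightarrow> real poly" where
  "flat_step p = [:0, 0, 1:] * (p - pderiv p)"

lemma poly_div_exp_tendsto_0: "((\<lambda>x::real. poly p x / exp x) \<longlongrightarrow> 0) at_top"
proof -
  have "((\<lambda>x::real. \<Sum>i\<le>degree p. coeff p i * (x ^ i / exp x)) \<longlongrightarrow> (\<Sum>i\<le>degree p. coeff p i * 0)) at_top"
    by (intro tendsto_sum tendsto_mult tendsto_const tendsto_power_div_exp_0)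
  then show ?thesis by (simp add: poly_altdef sum_divide_distrib)
qed

lemma flat_has_derivative: "(flat p has_real_derivative flat (flat_step p) t) (at t)"
proof -
  consider "t > 0" | "t < 0" | "t = 0" by linarith
  then show ?thesis
  proof cases
    case 1
    have "((\<lambda>t. poly p (1 / t) * exp (- 1 / t)) has_real_derivative flat (flat_step p) t) (at t)"
      using 1
      by (auto intro!: derivative_eq_intros DERIV_chain2[where f = "poly p", OF poly_DERIV]
          simp: flat_def flat_step_def field_simps power2_eq_square)
    then show ?thesis
      by (rule has_field_derivative_transform_within_open[of _ _ _ "{0<..}"])
        (use 1 in \<open>auto simp: flat_def\<close>)
  next
    case 2
    have "((\<lambda>t. 0) has_real_derivative flat (flat_step p) t) (at t)"
      using 2 by (simp add: flat_def)
    then show ?thesis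
      by (rule has_field_derivative_transform_within_open[of _ _ _ "{..<0}"])
        (use 2 in \<open>auto simp: flat_def\<close>)
  next
    case 3
    have "((\<lambda>h. poly (pCons 0 p) (inverse h) / exp (inverse h)) \<longlongrightarrow> 0) (at_right (0::real))"
      by (rule filterlim_compose[OF poly_div_exp_tendsto_0 filterlim_inverse_at_top_right])
    then have "((\<lambda>h. flat p h / h) \<longlongrightarrow> 0) (at_right 0)"
      by (rule Lim_transform_eventually)
        (auto simp: eventually_at_filter flat_def exp_minus field_simps)
    moreover have "((\<lambda>h. flat p h / h) \<longlongrightarrow> 0) (at_left 0)"
      by (rule Lim_transform_eventually[OF tendsto_const])
        (auto simp: eventually_at_filter flat_def)
    ultimately have "((\<lambda>h. flat p h / h) \<longlongrightarrow> 0) (at 0)"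
      by (simp add: filterlim_at_split)
    then show ?thesis using 3 by (simp add: DERIV_def flat_def)
  qed
qed

lemma continuous_flat: "continuous_on S (flat p)"
  using flat_has_derivative DERIV_continuous_on by (metis has_field_derivative_at_within)

lemma smooth_on_flat:
  assumes "open S" "smooth_on S u"
  shows "smooth_on S (\<lambda>x. flat p (u x))"
  using smooth_on_compose[OF assms(1) _ assms(2), of "\<lambda>n. flat ((flat_step ^^ n) p)" 0]
    flat_has_derivative by simp

lemma pd_flat:
  assumes "u differentiable (at x)"
  shows "pd i (\<lambda>x. flat p (u x)) x = flat (flat_step p) (u x) * pd i u x"
  using pd_compose_real[of "\<lambda>n. flat ((flat_step ^^ n) p)" u x i 0] flat_has_derivative assms
  by simp

text \<open>A smooth step from 1 down to 0: the inner \<open>flat\<close> is zero for \<open>|y|\<^sup>2 \<le> a\<close> and at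
  least the threshold \<open>flat 1 (b - a)\<close> for \<open>|y|\<^sup>2 \<ge> b\<close>, where the argument of the
  outer one is no longer positive.\<close>

definition cutoff :: "real \<Rightarrow> real \<Rightarrow> real^2 \<Rightarrow> real" where
  "cutoff a b y = flat 1 (flat 1 (b - a) - flat 1 (y \<bullet> y - a)) / flat 1 (flat 1 (b - a))"

text \<open>The derivative of the step with respect to \<open>s = |y|\<^sup>2\<close>.\<close>

definition cutoff_slope :: "real \<Rightarrow> real \<Rightarrow> real \<Rightarrow> real" where
  "cutoff_slope a b s = - flat [:0, 0, 1:] (flat 1 (b - a) - flat 1 (s - a)) * flat [:0, 0, 1:] (s - a)
    / flat 1 (flat 1 (b - a))"

lemma flat_one_pos: "t > 0 \<Longrightarrow> flat 1 t > 0"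
  by (simp add: flat_def)

lemma flat_one_mono: "s \<le> t \<Longrightarrow> flat 1 s \<le> flat 1 t"
  by (auto simp: flat_def field_simps)

lemma flat_one_strict_mono: "s < t \<Longrightarrow> 0 < t \<Longrightarrow> flat 1 s < flat 1 t"
  by (auto simp: flat_def field_simps)

lemma smooth_on_inner_self: "smooth_on UNIV (\<lambda>y::real^2. y \<bullet> y)"
proof -
  have "smooth_on UNIV (\<lambda>y::real^2. y $ 1 * y $ 1 + y $ 2 * y $ 2)"
    by (intro smooth_on_add smooth_on_mult smooth_on_vec_linear bounded_linear_vec_nth open_UNIV)
  then show ?thesis by (simp add: inner_vec_def sum_2)
qed

lemma smooth_on_cutoff: "smooth_on UNIV (cutoff a b)"
proof -
  have "smooth_on UNIV (\<lambda>y. inverse (flat 1 (flat 1 (b - a))) * flat 1 (flat 1 (b - a) - flat 1 (y \<bullet> y - a)))"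
    by (intro smooth_on_mult smooth_on_const smooth_on_flat smooth_on_diff smooth_on_inner_self open_UNIV)
  then show ?thesis by (simp add: cutoff_def[abs_def] field_simps)
qed

lemma cutoff_eq_1: "a < b \<Longrightarrow> y \<bullet> y \<le> a \<Longrightarrow> cutoff a b y = 1"
  using flat_one_pos[OF flat_one_pos, of "b - a"] by (simp add: cutoff_def flat_def)

lemma cutoff_eq_0: "b \<le> y \<bullet> y \<Longrightarrow> cutoff a b y = 0"
  using flat_one_mono[of "b - a" "y \<bullet> y - a"] by (simp add: cutoff_def flat_def)

lemma pd_cutoff: "pd i (cutoff a b) y = 2 * cutoff_slope a b (y \<bullet> y) * y $ i"
proof -
  let ?f = "flat 1 (b - a)"
  note sm = smooth_on_flat smooth_on_diff smooth_on_const smooth_on_inner_self open_UNIV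
  have sm1: "smooth_on UNIV (\<lambda>y::real^2. y \<bullet> y - a)" by (intro sm)
  have sm2: "smooth_on UNIV (\<lambda>y::real^2. ?f - flat 1 (y \<bullet> y - a))" by (intro sm)
  have sm3: "smooth_on UNIV (\<lambda>y::real^2. flat 1 (?f - flat 1 (y \<bullet> y - a)))" by (intro sm)
  have 1: "pd i (\<lambda>y. y \<bullet> y - a) y = 2 * y $ i"
    by (subst pd_eqI[where D = "\<lambda>h. 2 * (y \<bullet> h)"])
      (auto intro!: derivative_eq_intros simp: inner_axis inner_commute)
  have "pd i (\<lambda>y. ?f - flat 1 (y \<bullet> y - a)) y = - pd i (\<lambda>y. flat 1 (y \<bullet> y - a)) y"
    using pd_linear[OF bounded_linear_minus[OF bounded_linear_ident], of "\<lambda>y. flat 1 (y \<bullet> y - a)" y i]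
      pd_add[of "\<lambda>y. ?f" y "\<lambda>y. - flat 1 (y \<bullet> y - a)" i] smooth_on_differentiable[OF smooth_on_flat[OF open_UNIV sm1]]
    by simp
  also have "\<dots> = - flat [:0, 0, 1:] (y \<bullet> y - a) * (2 * y $ i)"
    using smooth_on_differentiable[OF sm1] by (simp add: pd_flat 1 flat_step_def)
  finally have 2: "pd i (\<lambda>y. ?f - flat 1 (y \<bullet> y - a)) y = - flat [:0, 0, 1:] (y \<bullet> y - a) * (2 * y $ i)" .
  have "pd i (\<lambda>y. flat 1 (?f - flat 1 (y \<bullet> y - a)) / flat 1 ?f) y
      = pd i (\<lambda>y. flat 1 (?f - flat 1 (y \<bullet> y - a))) y / flat 1 ?f"
    using pd_linear[OF bounded_linear_divide] smooth_on_differentiable[OF sm3] by blast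
  also have "\<dots> = 2 * cutoff_slope a b (y \<bullet> y) * y $ i"
    using smooth_on_differentiable[OF sm2] by (simp add: pd_flat 2 cutoff_slope_def flat_step_def)
  finally show ?thesis by (simp add: cutoff_def[abs_def])
qed

lemma cutoff_slope_eq_0: "s \<le> a \<or> b \<le> s \<Longrightarrow> cutoff_slope a b s = 0"
  using flat_one_mono[of "b - a" "s - a"] by (auto simp: cutoff_slope_def flat_def)

lemma cutoff_slope_neg: "a < s \<Longrightarrow> s < b \<Longrightarrow> cutoff_slope a b s < 0"
  using flat_one_strict_mono[of "s - a" "b - a"] flat_one_pos[OF flat_one_pos, of "b - a"]
  by (auto simp: cutoff_slope_def flat_def intro!: divide_neg_pos mult_neg_pos)

lemma cutoff_slope_nonpos: "cutoff_slope a b s \<le> 0"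
  using cutoff_slope_eq_0[of s a b] cutoff_slope_neg[of a s b] by fastforce

lemma continuous_cutoff_slope: "continuous_on S (cutoff_slope a b)"
  unfolding cutoff_slope_def[abs_def] divide_inverse
  by (intro continuous_intros continuous_on_compose2[OF continuous_flat[of UNIV]]) auto

lemma cutoff_test_function:
  assumes "cball 0 (sqrt b) \<subseteq> U"
  shows "cutoff a b \<in> test_functions U"
  using cutoff_eq_0[of b _ a]
  by (intro test_functionsI[OF smooth_on_cutoff _ assms])
    (auto simp: norm_eq_sqrt_inner not_le)

section \<open>Integration by parts and the fundamental lemma\<close>

lemma integrable_compact_support:
  fixes f :: "'a::euclidean_space \<Rightarrow> 'b::euclidean_space"
  assumes "continuous_on UNIV f" "compact K" "\<And>x. x \<notin> K \<Longrightarrow> f x = 0"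
  shows "integrable lborel f"
proof -
  have "integrable lborel (\<lambda>x. indicator K x *\<^sub>R f x)"
    using assms by (intro borel_integrable_compact) (auto intro: continuous_on_subset)
  also have "(\<lambda>x. indicator K x *\<^sub>R f x) = f"
    using assms(3) by (auto simp: indicator_def fun_eq_iff)
  finally show ?thesis .
qed

lemma integrable_test_function: "f \<in> test_functions U \<Longrightarrow> integrable lborel f"
  using integrable_compact_support[OF continuous_on_test_function test_functionsD(2) not_in_supp] .

lemma integral_translate:
  fixes f :: "real^2 \<Rightarrow> real"
  assumes "f \<in> borel_measurable borel"
  shows "(LINT x|lborel. f (x + c)) = (LINT x|lborel. f x)"
proof -
  have "(LINT x|lborel. f x) = (LINT x|distr lborel borel ((+) c). f x)"
    by (simp add: lborel_distr_plus)
  also have "\<dots> = (LINT x|lborel. f (c + x))"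
    using assms by (subst integral_distr) auto
  finally show ?thesis by (simp add: add.commute)
qed

lemma smooth_on_lipschitz:
  fixes f :: "real^2 \<Rightarrow> 'v::euclidean_space"
  assumes "smooth_on S f" "convex S" "\<And>i x. x \<in> S \<Longrightarrow> norm (pd i f x) \<le> C" "x \<in> S" "y \<in> S"
  shows "norm (f x - f y) \<le> 2 * C * norm (x - y)"
proof (rule differentiable_bound[OF assms(2) _ _ assms(4,5)])
  fix x assume x: "x \<in> S"
  show "(f has_derivative (\<lambda>h. \<Sum>i\<in>UNIV. (h $ i) *\<^sub>R pd i f x)) (at x within S)"
    using smooth_on_has_derivative[OF assms(1) x] by (rule has_derivative_at_withinI)
  show "onorm (\<lambda>h. \<Sum>i\<in>UNIV. (h $ i) *\<^sub>R pd i f x) \<le> 2 * C"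
  proof (rule onorm_le)
    fix h :: "real^2"
    have "norm (\<Sum>i\<in>UNIV. (h $ i) *\<^sub>R pd i f x) \<le> (\<Sum>i\<in>(UNIV :: 2 set). norm h * C)"
      by (rule sum_norm_le) (use assms(3)[OF x] component_le_norm_cart in \<open>auto intro!: mult_mono\<close>)
    then show "norm (\<Sum>i\<in>UNIV. (h $ i) *\<^sub>R pd i f x) \<le> 2 * C * norm h" by (simp add: mult_ac)
  qed
qed

text \<open>Translating \<open>f\<close> does not change its integral, so every difference quotient integrates to zero;
  the difference quotients converge dominatedly to the derivative.\<close>

lemma integral_pd_eq_0:
  fixes f :: "real^2 \<Rightarrow> real"
  assumes f: "f \<in> test_functions U"
  shows "(LINT x|lborel. pd i f x) = 0"
proof -
  define q where "q n x = real (Suc n) * (f (x + (1 / real (Suc n)) *\<^sub>R axis i 1) - f x)" for n x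
  obtain C1 C2 where C: "\<And>x. norm (pd 1 f x) \<le> C1" "\<And>x. norm (pd 2 f x) \<le> C2"
    using test_function_bounded[OF test_functions_pd[OF f]] by metis
  define C where "C = max C1 C2"
  have CC: "norm (pd j f x) \<le> C" for j x
    using C[of x] exhaust_2[of j] by (auto simp: C_def le_max_iff_disj)
  obtain R where R: "\<And>x. x \<in> supp f \<Longrightarrow> norm x \<le> R"
    using compact_imp_bounded[OF test_functionsD(2)[OF f]] by (auto simp: bounded_iff)
  have zero: "f x = 0" if "norm x > R" for x
    using R not_in_supp[of x f] that by fastforce
  note cont = continuous_on_test_function[OF f, of UNIV]
  have meas: "f \<in> borel_measurable borel"
    using cont by (rule borel_measurable_continuous_onI)
  have q0: "(LINT x|lborel. q n x) = 0" for n
  proof -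
    let ?c = "(1 / real (Suc n)) *\<^sub>R axis i 1 :: real^2"
    have "integrable lborel (\<lambda>x. f (x + ?c))"
    proof (rule integrable_compact_support[of _ "cball 0 (R + norm ?c)"])
      show "continuous_on UNIV (\<lambda>x. f (x + ?c))"
        by (intro continuous_on_compose2[OF cont] continuous_intros) auto
      show "f (x + ?c) = 0" if "x \<notin> cball 0 (R + norm ?c)" for x
        using that norm_diff_ineq[of x ?c] by (intro zero) (auto simp: not_le)
    qed auto
    then have "(LINT x|lborel. f (x + ?c) - f x) = 0"
      using integrable_test_function[OF f] integral_translate[OF meas] by simp
    then show ?thesis by (simp add: q_def)
  qed
  have bound: "norm (q n x) \<le> 2 * C * indicator (cball 0 (R + 1)) x" for n x
  proof (cases "norm x \<le> R + 1")
    case True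
    have "norm (f (x + (1 / real (Suc n)) *\<^sub>R axis i 1) - f x) \<le> 2 * C * (1 / real (Suc n))"
      using smooth_on_lipschitz[OF test_functionsD(1)[OF f], of C "x + (1 / real (Suc n)) *\<^sub>R axis i 1" x] CC
      by (simp add: norm_axis_1)
    then have "real (Suc n) * norm (f (x + (1 / real (Suc n)) *\<^sub>R axis i 1) - f x) \<le> 2 * C"
      by (simp add: field_simps del: of_nat_Suc)
    then show ?thesis using True
      by (simp add: q_def abs_mult del: of_nat_Suc)
  next
    case False
    have "norm ((1 / real (Suc n)) *\<^sub>R axis i 1 :: real^2) \<le> 1" by (simp add: norm_axis_1)
    then have "norm (x + (1 / real (Suc n)) *\<^sub>R axis i 1) > R"
      using False norm_diff_ineq[of x "(1 / real (Suc n)) *\<^sub>R axis i 1"] by linarith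
    then show ?thesis using False zero[of x] zero by (simp add: q_def)
  qed
  have "(\<lambda>n. LINT x|lborel. q n x) \<longlonglongrightarrow> (LINT x|lborel. pd i f x)"
  proof (rule integral_dominated_convergence[where w = "\<lambda>x. 2 * C * indicator (cball 0 (R + 1)) x"])
    show "pd i f \<in> borel_measurable lborel"
      using borel_measurable_continuous_onI[OF continuous_on_test_function[OF test_functions_pd[OF f]]]
      by simp
    show "q n \<in> borel_measurable lborel" for n
      unfolding q_def using meas by simp
    have "integrable lborel (indicator (cball 0 (R + 1)) :: real^2 \<Rightarrow> real)"
      using emeasure_lborel_cball_finite by (intro integrable_real_indicator) auto
    then show "integrable lborel (\<lambda>x::real^2. 2 * C * indicator (cball 0 (R + 1)) x)" by simp
    show "AE x in lborel. (\<lambda>n. q n x) \<longlonglongrightarrow> pd i f x"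
    proof (rule AE_I2)
      fix x
      obtain D where D: "(f has_derivative D) (at x)"
        using smooth_on_differentiable[OF test_functionsD(1)[OF f]] by (auto simp: differentiable_def)
      have "((\<lambda>t. f (x + t *\<^sub>R axis i 1)) has_derivative (\<lambda>t. D (t *\<^sub>R axis i 1))) (at 0)"
        by (rule has_derivative_compose[where g = f and f = "\<lambda>t. x + t *\<^sub>R axis i 1"])
          (use D in \<open>auto intro!: derivative_eq_intros\<close>)
      then have "((\<lambda>t. f (x + t *\<^sub>R axis i 1)) has_real_derivative pd i f x) (at 0)"
        unfolding has_field_derivative_def
        using linear_scale[OF has_derivative_linear[OF D]] pd_eqI[OF D, of i]
        by (simp add: mult_commute_abs)
      then have *: "((\<lambda>t. (f (x + t *\<^sub>R axis i 1) - f x) / t) \<longlongrightarrow> pd i f x) (at 0)"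
        by (simp add: DERIV_def)
      have "filterlim (\<lambda>n. 1 / real (Suc n)) (at 0) sequentially"
        unfolding filterlim_at using LIMSEQ_Suc[OF lim_1_over_n] by simp
      from filterlim_compose[OF * this] show "(\<lambda>n. q n x) \<longlonglongrightarrow> pd i f x"
        by (simp add: q_def mult.commute)
    qed
  qed (use bound in auto)
  then show ?thesis using q0 LIMSEQ_unique[OF tendsto_const] by fastforce
qed

lemma integral_by_parts:
  fixes f \<phi> :: "real^2 \<Rightarrow> real"
  assumes "open U" "smooth_on U f" "\<phi> \<in> test_functions U"
  shows "(LINT x|lborel. f x * pd i \<phi> x) = - (LINT x|lborel. pd i f x * \<phi> x)"
proof -
  have tf: "(\<lambda>x. \<phi> x * f x) \<in> test_functions U"
    using assms by (intro test_functions_mult)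
  have "pd i (\<lambda>x. \<phi> x * f x) x = f x * pd i \<phi> x + pd i f x * \<phi> x" for x
  proof (cases "x \<in> U")
    case True
    then show ?thesis
      using pd_bilinear[OF bounded_bilinear_mult, of \<phi> x f i]
        smooth_on_differentiable[OF assms(2)] smooth_on_differentiable[OF test_functionsD(1)[OF assms(3)]]
      by (simp add: mult.commute)
  next
    case False
    have "supp (\<lambda>x. \<phi> x * f x) \<subseteq> U" "supp \<phi> \<subseteq> U" using test_functionsD(3)[OF tf] test_functionsD(3)[OF assms(3)] by auto
    then have "x \<notin> supp (\<lambda>x. \<phi> x * f x)" "x \<notin> supp \<phi>" using False by auto
    then show ?thesis
      using pds_not_in_supp[of x "\<lambda>x. \<phi> x * f x" "[i]"] pds_not_in_supp[of x \<phi> "[i]"] not_in_supp[of x \<phi>]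
      by simp
  qed
  moreover have "(\<lambda>x. pd i \<phi> x * f x) \<in> test_functions U" "(\<lambda>x. \<phi> x * pd i f x) \<in> test_functions U"
    using assms by (intro test_functions_mult test_functions_pd smooth_on_pd; simp)+
  then have "integrable lborel (\<lambda>x. f x * pd i \<phi> x)" "integrable lborel (\<lambda>x. pd i f x * \<phi> x)"
    by (simp_all add: integrable_test_function mult.commute)
  ultimately show ?thesis
    using integral_pd_eq_0[OF tf, of i] by simp
qed

lemma continuous_nonneg_integral_eq_0:
  fixes f :: "real^2 \<Rightarrow> real"
  assumes "continuous_on UNIV f" "integrable lborel f" "\<And>x. 0 \<le> f x" "(LINT x|lborel. f x) = 0"
  shows "f x = 0"
proof -
  have "AE x in lborel. f x = 0"
    using integral_nonneg_eq_0_iff_AE[OF assms(2)] assms(3,4) by simp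
  then have "AE x in lebesgue. x \<in> {x. f x = 0}" by (auto intro: AE_completion)
  moreover have "closed {x. f x = 0}"
    by (intro closed_Collect_eq assms(1) continuous_on_const)
  ultimately show ?thesis using mem_closed_if_AE_lebesgue by blast
qed

text \<open>Testing \<open>c\<close> against \<open>\<eta> c\<close> with a nonnegative bump \<open>\<eta>\<close> gives the
  integral of \<open>\<eta> c\<^sup>2\<close>.\<close>

lemma fundamental_lemma:
  fixes c :: "real^2 \<Rightarrow> real"
  assumes U: "open U" and c: "smooth_on U c" and x: "x \<in> U"
    and 0: "\<And>\<phi>. \<phi> \<in> test_functions U \<Longrightarrow> (LINT y|lborel. c y * \<phi> y) = 0"
  shows "c x = 0"
proof -
  obtain d where d: "d > 0" "cball x d \<subseteq> U" using U x open_contains_cball by blast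
  define b where "b y = cutoff (d\<^sup>2 / 2) (d\<^sup>2) (1 *\<^sub>R y + (- x))" for y
  have bx: "b x = 1" using d by (simp add: b_def cutoff_eq_1)
  have b: "b \<in> test_functions U"
  proof (rule test_functionsI[OF _ _ d(2)])
    show "smooth_on UNIV b" unfolding b_def by (rule smooth_on_affine[OF smooth_on_cutoff])
    show "b y = 0" if "y \<notin> cball x d" for y
    proof -
      have "d < norm (y - x)" using that by (simp add: dist_norm norm_minus_commute)
      then have "d\<^sup>2 < (norm (y - x))\<^sup>2" using d by (intro power_strict_mono) auto
      then show ?thesis by (simp add: b_def cutoff_eq_0 power2_norm_eq_inner)
    qed
  qed auto
  have b_nonneg: "0 \<le> b y" for y by (simp add: b_def cutoff_def flat_def)
  have bc: "(\<lambda>y. b y * c y) \<in> test_functions U" using test_functions_mult[OF U b c] .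
  have bcc: "(\<lambda>y. b y * c y * c y) \<in> test_functions U" using test_functions_mult[OF U bc c] .
  have "b x * c x * c x = 0"
    by (rule continuous_nonneg_integral_eq_0[OF continuous_on_test_function[OF bcc] integrable_test_function[OF bcc]])
      (use b_nonneg 0[OF bc] in \<open>auto simp: mult.assoc mult.left_commute[of "c _"] \<close>)
  then show ?thesis using bx by simp
qed

section \<open>Circulation along circles\<close>

definition circ :: "real \<Rightarrow> real^2" where
  "circ t = cos t *\<^sub>R axis 1 1 + sin t *\<^sub>R axis 2 1"

lemma circ_nth [simp]: "circ t $ 1 = cos t" "circ t $ 2 = sin t"
  by (simp_all add: circ_def axis_def)

lemma inner_vec_2: "(x::real^2) \<bullet> y = x $ 1 * y $ 1 + x $ 2 * y $ 2"
  by (simp add: inner_vec_def sum_2)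

lemma circ_inner [simp]: "circ t \<bullet> circ t = 1"
  by (simp add: inner_vec_2 flip: power2_eq_square)

lemma norm_circ [simp]: "norm (circ t) = 1"
  by (simp add: norm_eq_sqrt_inner)

lemma circ_polar: "\<exists>s\<ge>0. y = norm y *\<^sub>R circ s"
proof (cases "y = 0")
  case False
  have "(y $ 1 / norm y)\<^sup>2 + (y $ 2 / norm y)\<^sup>2 = (y \<bullet> y) / (norm y)\<^sup>2"
    by (simp add: inner_vec_2 power_divide power2_eq_square add_divide_distrib)
  also have "\<dots> = 1" using False by (simp add: power2_norm_eq_inner)
  finally obtain s where s: "s \<ge> 0" "y $ 1 / norm y = cos s" "y $ 2 / norm y = sin s"
    using sincos_total_2pi by metis
  have "y $ 1 = norm y * cos s" "y $ 2 = norm y * sin s" using False by (simp_all flip: s(2,3))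
  then have "y = norm y *\<^sub>R circ s" by (simp only: vec_eq_iff forall_2 vector_scaleR_component circ_nth real_scaleR_def)
  then show ?thesis using s(1) by blast
qed auto

lemma continuous_circ [continuous_intros]:
  fixes f :: "'a::t2_space \<Rightarrow> real"
  shows "continuous_on S f \<Longrightarrow> continuous_on S (\<lambda>x. circ (f x))"
  unfolding circ_def by (intro continuous_intros continuous_on_cos continuous_on_sin)

definition circulation :: "(real^2 \<Rightarrow> real) \<Rightarrow> (real^2 \<Rightarrow> real) \<Rightarrow> real \<Rightarrow> real" where
  "circulation V1 V2 \<rho> =
    integral {0..2 * pi} (\<lambda>t. \<rho> * (cos t * V2 (\<rho> *\<^sub>R circ t) - sin t * V1 (\<rho> *\<^sub>R circ t)))"

lemma smooth_on_curve_derivative: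
  fixes g :: "real^2 \<Rightarrow> real"
  assumes "smooth_on U g" "\<gamma> t \<in> U" "(\<gamma> has_vector_derivative v) (at t)"
  shows "((\<lambda>t. g (\<gamma> t)) has_real_derivative (v $ 1 * pd 1 g (\<gamma> t) + v $ 2 * pd 2 g (\<gamma> t))) (at t)"
proof -
  have "((\<lambda>t. g (\<gamma> t)) has_derivative (\<lambda>h. \<Sum>i\<in>UNIV. ((h *\<^sub>R v) $ i) *\<^sub>R pd i g (\<gamma> t))) (at t)"
    by (rule has_derivative_compose[where g = g and f = \<gamma>])
      (use assms smooth_on_has_derivative[OF assms(1,2)] in \<open>auto simp: has_vector_derivative_def\<close>)
  then show ?thesis
    unfolding has_field_derivative_def by (simp add: sum_2 distrib_left[symmetric] mult.assoc mult_commute_abs)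
qed

text \<open>Differentiating the circulation of a curl-free field in the radius gives the integral of the
  angular derivative of the radial component, which vanishes by periodicity.\<close>

lemma circulation_constant:
  assumes U: "open U" "cball 0 R - {0} \<subseteq> U" and V: "smooth_on U V1" "smooth_on U V2"
    and curl: "\<And>x. x \<in> U \<Longrightarrow> pd 1 V2 x = pd 2 V1 x"
    and \<rho>: "0 < \<rho>" "\<rho> \<le> R"
  shows "circulation V1 V2 \<rho> = circulation V1 V2 R"
proof -
  let ?I = "{0<..R}"
  define f where "f \<rho> t = \<rho> * (cos t * V2 (\<rho> *\<^sub>R circ t) - sin t * V1 (\<rho> *\<^sub>R circ t))" for \<rho> t
  define fx where "fx \<rho> t = (cos t * V2 (\<rho> *\<^sub>R circ t) - sin t * V1 (\<rho> *\<^sub>R circ t)) +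
    \<rho> * (cos t * (cos t * pd 1 V2 (\<rho> *\<^sub>R circ t) + sin t * pd 2 V2 (\<rho> *\<^sub>R circ t)) -
      sin t * (cos t * pd 1 V1 (\<rho> *\<^sub>R circ t) + sin t * pd 2 V1 (\<rho> *\<^sub>R circ t)))" for \<rho> t
  have inU: "\<rho> *\<^sub>R circ t \<in> U" if "\<rho> \<in> ?I" for \<rho> t
  proof -
    have "norm (\<rho> *\<^sub>R circ t) = \<rho>" using that by simp
    then have "\<rho> *\<^sub>R circ t \<in> cball 0 R - {0}" using that by (auto simp del: norm_scaleR)
    then show ?thesis using U(2) by auto
  qed
  have cont: "continuous_on (?I \<times> T) (\<lambda>(\<rho>, t). g (\<rho> *\<^sub>R circ t))" if "smooth_on U g" for g :: "real^2 \<Rightarrow> real" and T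
    unfolding split_beta
    by (intro continuous_on_compose2[OF smooth_on_continuous_on[OF that]] continuous_intros)
      (use inU in auto)
  have cont1: "continuous_on T (\<lambda>t. g (\<rho> *\<^sub>R circ t))" if "smooth_on U g" "\<rho> \<in> ?I" for g :: "real^2 \<Rightarrow> real" and T \<rho>
    by (intro continuous_on_compose2[OF smooth_on_continuous_on[OF that(1)]] continuous_intros)
      (use inU that in auto)
  have d\<rho>: "((\<lambda>\<rho>. g (\<rho> *\<^sub>R circ t)) has_real_derivative
      (cos t * pd 1 g (\<rho> *\<^sub>R circ t) + sin t * pd 2 g (\<rho> *\<^sub>R circ t))) (at \<rho>)"
    if "smooth_on U g" "\<rho> \<in> ?I" for g \<rho> t
  proof -
    have "((\<lambda>\<rho>. \<rho> *\<^sub>R circ t) has_vector_derivative circ t) (at \<rho>)"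
      by (auto intro!: derivative_eq_intros simp: has_vector_derivative_def)
    from smooth_on_curve_derivative[OF that(1) _ this] inU[OF that(2)] show ?thesis by simp
  qed
  have dt: "((\<lambda>t. g (\<rho> *\<^sub>R circ t)) has_real_derivative
      (- \<rho> * sin t * pd 1 g (\<rho> *\<^sub>R circ t) + \<rho> * cos t * pd 2 g (\<rho> *\<^sub>R circ t))) (at t)"
    if "smooth_on U g" "\<rho> \<in> ?I" for g \<rho> t
  proof -
    have "((\<lambda>t. \<rho> *\<^sub>R circ t) has_vector_derivative
        \<rho> *\<^sub>R (- sin t *\<^sub>R axis 1 1 + cos t *\<^sub>R axis 2 1)) (at t)"
      unfolding circ_def
      by (auto intro!: derivative_eq_intros simp: has_vector_derivative_def)
        (auto simp: vec_eq_iff axis_def algebra_simps)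
    from smooth_on_curve_derivative[OF that(1) _ this] inU[OF that(2)] show ?thesis
      by (simp add: axis_def)
  qed
  have integral_fx: "integral {0..2 * pi} (fx \<rho>) = 0" if "\<rho> \<in> ?I" for \<rho>
  proof -
    let ?H = "\<lambda>t. cos t * V1 (\<rho> *\<^sub>R circ t) + sin t * V2 (\<rho> *\<^sub>R circ t)"
    have "(?H has_real_derivative fx \<rho> t) (at t)" for t
      by (rule DERIV_cong, (rule derivative_intros dt V that)+)
        (simp add: fx_def curl[OF inU[OF that]] algebra_simps)
    then have "(fx \<rho> has_integral ?H (2 * pi) - ?H 0) {0..2 * pi}"
      by (intro fundamental_theorem_of_calculus)
        (auto simp flip: has_real_derivative_iff_has_vector_derivative
          intro: has_field_derivative_at_within)
    moreover have "circ (2 * pi) = circ 0" by (simp add: circ_def)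
    ultimately show ?thesis by (simp add: integral_unique)
  qed
  have "((\<lambda>\<rho>. integral {0..2 * pi} (f \<rho>)) has_real_derivative 0) (at \<rho> within ?I)" if "\<rho> \<in> ?I" for \<rho>
  proof -
    have "((\<lambda>\<rho>. integral (cbox 0 (2 * pi)) (f \<rho>)) has_real_derivative
        integral (cbox 0 (2 * pi)) (fx \<rho>)) (at \<rho> within ?I)"
    proof (rule leibniz_rule_field_derivative[OF _ _ _ that])
      fix \<rho> t assume "\<rho> \<in> ?I"
      then have "((\<lambda>\<rho>. f \<rho> t) has_real_derivative fx \<rho> t) (at \<rho>)"
        unfolding f_def fx_def
        by (auto intro!: derivative_eq_intros d\<rho> V simp: algebra_simps)
      then show "((\<lambda>\<rho>. f \<rho> t) has_real_derivative fx \<rho> t) (at \<rho> within ?I)"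
        by (rule has_field_derivative_at_within)
    next
      fix \<rho> assume "\<rho> \<in> ?I"
      then show "f \<rho> integrable_on cbox 0 (2 * pi)"
        unfolding f_def by (intro integrable_continuous continuous_intros cont1 V)
    next
      note c = cont[OF V(1)] cont[OF V(2)] cont[OF smooth_on_pd[OF V(1)]] cont[OF smooth_on_pd[OF V(2)]]
      show "continuous_on (?I \<times> cbox 0 (2 * pi)) (\<lambda>(\<rho>, t). fx \<rho> t)"
        using c unfolding fx_def split_beta by (intro continuous_intros)
    qed (auto)
    then show ?thesis using integral_fx[OF that] by simp
  qed
  then have "\<exists>c. \<forall>\<rho>\<in>?I. integral {0..2 * pi} (f \<rho>) = c"
    by (intro has_field_derivative_zero_constant) auto
  then show ?thesis using \<rho> by (auto simp: circulation_def f_def[abs_def])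
qed

definition rot :: "real \<Rightarrow> real^2 \<Rightarrow> real^2" where
  "rot t y = (cos t * y $ 1 - sin t * y $ 2) *\<^sub>R axis 1 1 + (sin t * y $ 1 + cos t * y $ 2) *\<^sub>R axis 2 1"

lemma rot_nth [simp]: "rot t y $ 1 = cos t * y $ 1 - sin t * y $ 2"
  "rot t y $ 2 = sin t * y $ 1 + cos t * y $ 2"
  by (simp_all add: rot_def axis_def)

lemma rot_circ: "rot t (\<rho> *\<^sub>R circ s) = \<rho> *\<^sub>R circ (t + s)"
  by (simp add: vec_eq_iff forall_2 cos_add sin_add algebra_simps)

lemma rot_inner: "rot t x \<bullet> rot t y = x \<bullet> y"
proof -
  have "cos t * cos t = 1 - sin t * sin t"
    using sin_cos_squared_add3[of t] by linarith
  then show ?thesis by (simp add: inner_vec_2) algebra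
qed

lemma orthogonal_transformation_rot: "orthogonal_transformation (rot t)"
  unfolding orthogonal_transformation_def
  by (auto intro!: linearI simp: rot_inner vec_eq_iff forall_2 algebra_simps)

lemma lborel_distr_orthogonal:
  fixes f :: "real^2 \<Rightarrow> real^2"
  assumes f: "orthogonal_transformation f"
  shows "distr lborel borel f = lborel"
proof (rule lborel_eqI[symmetric])
  fix l u :: "real^2" assume lu: "\<And>b. b \<in> Basis \<Longrightarrow> l \<bullet> b \<le> u \<bullet> b"
  have lin: "linear f" and bij: "bij f" and inv: "orthogonal_transformation (inv f)"
    using f orthogonal_transformation_linear orthogonal_transformation_bij orthogonal_transformation_inv by auto
  have meas: "f \<in> borel_measurable borel"
    using lin by (intro borel_measurable_continuous_onI linear_continuous_on) (simp add: linear_conv_bounded_linear)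
  have vim: "f -` box l u = inv f ` box l u" using bij by (simp add: bij_vimage_eq_inv_image)
  have "inv f ` box l u \<in> lmeasurable"
    by (rule measurable_orthogonal_image[OF inv lmeasurable_box])
  then have eq: "emeasure lebesgue (inv f ` box l u) = ennreal (measure lebesgue (inv f ` box l u))"
    by (rule emeasure_eq_measure2)
  have "f -` box l u \<in> sets borel" using measurable_sets_borel[OF meas] by simp
  then have "emeasure (distr lborel borel f) (box l u) = emeasure lebesgue (f -` box l u)"
    using meas by (simp add: emeasure_distr)
  also have "\<dots> = ennreal (measure lebesgue (f -` box l u))"
    unfolding vim by (rule eq)
  also have "\<dots> = ennreal (measure lebesgue (box l u))"
    unfolding vim using measure_orthogonal_image[OF inv, of "box l u"] by (simp add: lmeasurable_box)
  also have "\<dots> = emeasure lborel (box l u)"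
    using emeasure_eq_measure2[OF lmeasurable_box, of l u] by simp
  also have "\<dots> = (\<Prod>b\<in>Basis. (u - l) \<bullet> b)"
    using lu by (rule emeasure_lborel_box)
  finally show "emeasure (distr lborel borel f) (box l u) = (\<Prod>b\<in>Basis. (u - l) \<bullet> b)" .
qed simp

text \<open>Together with Fubini's theorem, the rotation invariance of Lebesgue measure takes the place of polar
  coordinates.\<close>

lemma integral_rotation_average:
  fixes F :: "real^2 \<Rightarrow> real"
  assumes cont: "continuous_on UNIV F" and R: "\<And>y. norm y > R \<Longrightarrow> F y = 0"
  shows "(LINT y|lborel. integral {0..2 * pi} (\<lambda>t. F (rot t y))) = 2 * pi * (LINT y|lborel. F y)"
proof -
  let ?f = "\<lambda>t y. indicator {0..2 * pi} t *\<^sub>R F (rot t y)"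
  have norm_rot: "norm (rot t y) = norm y" for t y
    by (simp add: norm_eq_sqrt_inner rot_inner)
  have cont_rot: "continuous_on S (\<lambda>p. F (rot (fst p) (snd p)))" for S
    unfolding rot_def by (intro continuous_on_compose2[OF cont] continuous_intros) auto
  have cont_rot1: "continuous_on S (\<lambda>t. F (rot t y))" for S y
    unfolding rot_def by (intro continuous_on_compose2[OF cont] continuous_intros) auto
  have meas: "F \<in> borel_measurable borel" using cont by (rule borel_measurable_continuous_onI)
  have "integrable lborel (\<lambda>p. indicator ({0..2 * pi} \<times> cball 0 R) p *\<^sub>R F (rot (fst p) (snd p)))"
    by (intro borel_integrable_compact compact_Times cont_rot) auto
  also have "(\<lambda>p. indicator ({0..2 * pi} \<times> cball 0 R) p *\<^sub>R F (rot (fst p) (snd p))) = case_prod ?f"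
    using R by (auto simp: fun_eq_iff indicator_def norm_rot not_le)
  finally have int: "integrable (lborel \<Otimes>\<^sub>M lborel) (case_prod ?f)" by (simp add: lborel_prod)
  have inner: "(LINT y|lborel. F (rot t y)) = (LINT y|lborel. F y)" for t
  proof -
    have "rot t \<in> borel_measurable borel"
      using orthogonal_transformation_linear[OF orthogonal_transformation_rot]
      by (intro borel_measurable_continuous_onI linear_continuous_on) (simp add: linear_conv_bounded_linear)
    then have "(LINT y|distr lborel borel (rot t). F y) = (LINT y|lborel. F (rot t y))"
      using meas by (intro integral_distr) auto
    then show ?thesis by (simp add: lborel_distr_orthogonal[OF orthogonal_transformation_rot])
  qed
  have "integral {0..2 * pi} (\<lambda>t. F (rot t y)) = (LINT t|lborel. ?f t y)" for y
  proof -
    have "set_integrable lborel {0..2 * pi} (\<lambda>t. F (rot t y))"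
      unfolding set_integrable_def by (intro borel_integrable_compact cont_rot1) auto
    then show ?thesis
      using set_borel_integral_eq_integral(2)[of "{0..2 * pi}" "\<lambda>t. F (rot t y)"]
      by (simp add: set_lebesgue_integral_def)
  qed
  then have "(LINT y|lborel. integral {0..2 * pi} (\<lambda>t. F (rot t y))) = (LINT y|lborel. LINT t|lborel. ?f t y)"
    by simp
  also have "\<dots> = (LINT t|lborel. LINT y|lborel. ?f t y)"
    by (rule lborel_pair.Fubini_integral[OF int])
  also have "\<dots> = (LINT t|lborel. indicator {0..2 * pi} t *\<^sub>R (LINT y|lborel. F y))"
    by (simp add: inner)
  also have "\<dots> = 2 * pi * (LINT y|lborel. F y)"
    by simp
  finally show ?thesis .
qed

lemma integral_periodic_shift:
  fixes f :: "real \<Rightarrow> real"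
  assumes cont: "continuous_on UNIV f" and per: "\<And>t. f (t + p) = f t" and "p \<ge> 0" "s \<ge> 0"
  shows "integral {0..p} (\<lambda>t. f (t + s)) = integral {0..p} f"
proof -
  have int: "f integrable_on {a..b}" for a b
    by (rule integrable_continuous_real) (rule continuous_on_subset[OF cont], simp)
  have "integral {0..s} f + integral {s..s + p} f = integral {0..s + p} f"
    using assms int by (intro Henstock_Kurzweil_Integration.integral_combine) auto
  also have "\<dots> = integral {0..p} f + integral {p..s + p} f"
    using assms int by (intro Henstock_Kurzweil_Integration.integral_combine[symmetric]) auto
  also have "integral {p..s + p} f = integral {0..s} f"
    using integral_shift_Icc_real[of 0 s f p] per by (simp add: o_def add.commute)
  finally show ?thesis
    using integral_shift_Icc_real[of 0 p f s] by (simp add: o_def add.commute)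
qed

text \<open>The universal factor between the circulation of a curl-free field and its pairing with the gradient
  of the cutoff. It is not zero because the slope of the cutoff is negative inside the annulus.\<close>

definition cutoff_weight :: "real \<Rightarrow> real \<Rightarrow> real" where
  "cutoff_weight a b = (LINT y|lborel. cutoff_slope a b ((y::real^2) \<bullet> y)) / pi"

lemma cutoff_weight_nonzero:
  assumes "0 \<le> a" "a < b"
  shows "cutoff_weight a b \<noteq> 0"
proof
  assume "cutoff_weight a b = 0"
  then have 0: "(LINT y|lborel. - cutoff_slope a b ((y::real^2) \<bullet> y)) = 0"
    by (simp add: cutoff_weight_def)
  have cont: "continuous_on UNIV (\<lambda>y::real^2. - cutoff_slope a b (y \<bullet> y))"
    by (intro continuous_intros continuous_on_compose2[OF continuous_cutoff_slope]) auto
  have "- cutoff_slope a b (y \<bullet> y) = 0" for y :: "real^2"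
  proof (rule continuous_nonneg_integral_eq_0[OF cont _ _ 0])
    show "integrable lborel (\<lambda>y::real^2. - cutoff_slope a b (y \<bullet> y))"
      by (rule integrable_compact_support[OF cont, of "cball 0 (sqrt b)"])
        (auto simp: norm_eq_sqrt_inner not_le intro!: cutoff_slope_eq_0)
    show "0 \<le> - cutoff_slope a b (x \<bullet> x)" for x :: "real^2"
      using cutoff_slope_nonpos[of a b "x \<bullet> x"] by simp
  qed
  from this[of "sqrt ((a + b) / 2) *\<^sub>R circ 0"] show False
    using cutoff_slope_neg[of a "(a + b) / 2" b] assms by simp
qed

lemma pd_cutoff_test_function:
  assumes U: "open U" "cball 0 R - {0} \<subseteq> U" and a: "0 < a" "a < R\<^sup>2" "R > 0"
  shows "pd i (cutoff a (R\<^sup>2)) \<in> test_functions U"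
proof (rule test_functionsI[of _ "cball 0 R - ball 0 (sqrt a)"])
  show "pd i (cutoff a (R\<^sup>2)) x = 0" if "x \<notin> cball 0 R - ball 0 (sqrt a)" for x
  proof -
    have "norm x > R \<or> norm x < sqrt a" using that by auto
    then have "(norm x)\<^sup>2 \<le> a \<or> R\<^sup>2 \<le> (norm x)\<^sup>2"
      using a power_mono[of "norm x" "sqrt a" 2] power_mono[of R "norm x" 2] by auto
    then show ?thesis unfolding pd_cutoff by (simp add: cutoff_slope_eq_0 power2_norm_eq_inner)
  qed
qed (use a U in \<open>auto intro: compact_diff smooth_on_pd smooth_on_cutoff\<close>)

text \<open>The gradient of the cutoff is radial, so the integrand is the slope times the circulation density.
  Averaging over all rotations turns the density into the circulation along the circle through the
  point, which is the same for every radius.\<close>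

lemma integral_cutoff_circulation:
  assumes U: "open U" "cball 0 R - {0} \<subseteq> U" and V: "smooth_on U V1" "smooth_on U V2"
    and curl: "\<And>x. x \<in> U \<Longrightarrow> pd 1 V2 x = pd 2 V1 x"
    and a: "0 < a" "a < R\<^sup>2" "R > 0"
  shows "(LINT y|lborel. V2 y * pd 1 (cutoff a (R\<^sup>2)) y - V1 y * pd 2 (cutoff a (R\<^sup>2)) y)
    = cutoff_weight a (R\<^sup>2) * circulation V1 V2 R"
proof -
  let ?\<kappa> = "cutoff_slope a (R\<^sup>2)"
  define F where "F y = V2 y * pd 1 (cutoff a (R\<^sup>2)) y - V1 y * pd 2 (cutoff a (R\<^sup>2)) y" for y
  have F_eq: "F y = 2 * ?\<kappa> (y \<bullet> y) * (y $ 1 * V2 y - y $ 2 * V1 y)" for y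
    by (simp add: F_def pd_cutoff algebra_simps)
  note pdc = pd_cutoff_test_function[OF U a]
  have F: "F \<in> test_functions U"
    unfolding F_def using test_functions_mult[OF U(1) pdc] V
    by (intro test_functions_diff) (auto simp: mult.commute)
  note contF = continuous_on_test_function[OF F]
  have avg: "integral {0..2 * pi} (\<lambda>t. F (rot t y)) = 2 * ?\<kappa> (y \<bullet> y) * circulation V1 V2 R" for y
  proof -
    obtain s where s: "s \<ge> 0" "y = norm y *\<^sub>R circ s" using circ_polar by blast
    define \<rho> where "\<rho> = norm y"
    have y: "y = \<rho> *\<^sub>R circ s" "y \<bullet> y = \<rho>\<^sup>2" and "\<rho> \<ge> 0"
      using s by (simp_all add: \<rho>_def power2_norm_eq_inner)
    define h where "h t = F (\<rho> *\<^sub>R circ t)" for t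
    have "continuous_on UNIV h"
      unfolding h_def by (intro continuous_on_compose2[OF contF] continuous_intros) auto
    moreover have "h (t + 2 * pi) = h t" for t by (simp add: h_def circ_def)
    ultimately have "integral {0..2 * pi} (\<lambda>t. h (t + s)) = integral {0..2 * pi} h"
      using s(1) by (intro integral_periodic_shift) auto
    moreover have "F (rot t y) = h (t + s)" for t
      by (simp add: y(1) rot_circ h_def)
    moreover have "h t = 2 * ?\<kappa> (\<rho>\<^sup>2) * (\<rho> * (cos t * V2 (\<rho> *\<^sub>R circ t) - sin t * V1 (\<rho> *\<^sub>R circ t)))" for t
      by (simp add: h_def F_eq algebra_simps flip: power2_eq_square)
    then have "h = (\<lambda>t. 2 * ?\<kappa> (\<rho>\<^sup>2) * (\<rho> * (cos t * V2 (\<rho> *\<^sub>R circ t) - sin t * V1 (\<rho> *\<^sub>R circ t))))"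
      by (rule ext)
    then have "integral {0..2 * pi} h = 2 * ?\<kappa> (\<rho>\<^sup>2) * circulation V1 V2 \<rho>"
      unfolding circulation_def by (simp only: integral_mult_right)
    moreover have "?\<kappa> (\<rho>\<^sup>2) * circulation V1 V2 \<rho> = ?\<kappa> (\<rho>\<^sup>2) * circulation V1 V2 R"
    proof (cases "0 < \<rho> \<and> \<rho> \<le> R")
      case True
      then have "circulation V1 V2 \<rho> = circulation V1 V2 R"
        by (intro circulation_constant[OF U V curl]) auto
      then show ?thesis by simp
    next
      case False
      then have "\<rho> = 0 \<or> R \<le> \<rho>" using \<open>\<rho> \<ge> 0\<close> by auto
      then have "\<rho>\<^sup>2 \<le> a \<or> R\<^sup>2 \<le> \<rho>\<^sup>2" using a by (auto intro: power_mono)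
      then show ?thesis by (simp add: cutoff_slope_eq_0)
    qed
    ultimately show ?thesis by (simp add: y(2))
  qed
  have "2 * pi * (LINT y|lborel. F y) = (LINT y|lborel. integral {0..2 * pi} (\<lambda>t. F (rot t y)))"
  proof (rule integral_rotation_average[OF contF, symmetric, of R])
    fix y :: "real^2" assume "norm y > R"
    then have "R\<^sup>2 \<le> y \<bullet> y" using a by (auto simp flip: power2_norm_eq_inner intro: power_mono)
    then show "F y = 0" by (simp add: F_eq cutoff_slope_eq_0)
  qed
  also have "\<dots> = 2 * (LINT y|lborel. ?\<kappa> ((y::real^2) \<bullet> y)) * circulation V1 V2 R"
    by (simp add: avg)
  finally show ?thesis by (simp add: F_def cutoff_weight_def field_simps)
qed

section \<open>Distributions supported at the origin\<close>

lemma distribution_on_linear: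
  assumes "distribution_on U T" "f \<in> test_functions U" "g \<in> test_functions U"
  shows "T (\<lambda>x. a *\<^sub>R f x + b *\<^sub>R g x) = a * T f + b * T g"
  using assms unfolding distribution_on_def by blast

lemma distribution_on_scale:
  assumes "distribution_on U T" "f \<in> test_functions U"
  shows "T (\<lambda>x. a *\<^sub>R f x) = a * T f"
  using distribution_on_linear[OF assms(1,2,2), of a 0] by simp

lemma distribution_on_diff:
  assumes "distribution_on U T" "f \<in> test_functions U" "g \<in> test_functions U"
  shows "T (\<lambda>x. f x - g x) = T f - T g"
  using distribution_on_linear[OF assms, of 1 "-1"] by simp

lemma distribution_on_zero:
  assumes "distribution_on U T"
  shows "T (\<lambda>x. 0) = 0"
  using distribution_on_scale[OF assms test_functions_zero, of 0] by simp

text \<open>Each derivative may cost one power of \<open>\<delta>\<close>. Both the dilated cutoffs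
  \<open>\<eta>(x/\<delta>)\<close> (with \<open>k = 0\<close>) and a fixed function that vanishes to order \<open>k\<close>
  at the origin are of this kind, and the exponents add up under multiplication.\<close>

definition order_at_scale :: "real \<Rightarrow> (real \<Rightarrow> real^2 \<Rightarrow> real) \<Rightarrow> bool" where
  "order_at_scale k F \<longleftrightarrow> (\<forall>\<delta>\<in>{0<..1}. smooth_on UNIV (F \<delta>)) \<and>
    (\<forall>is. \<exists>C. \<forall>\<delta>\<in>{0<..1}. \<forall>x\<in>cball 0 \<delta>. \<bar>pds is (F \<delta>) x\<bar> \<le> C * \<delta> powr (k - length is))"

lemma order_at_scale_pd:
  assumes "order_at_scale k F"
  shows "order_at_scale (k - 1) (\<lambda>\<delta>. pd i (F \<delta>))"
  unfolding order_at_scale_def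
proof (intro conjI allI)
  show "\<forall>\<delta>\<in>{0<..1}. smooth_on UNIV (pd i (F \<delta>))"
    using assms smooth_on_pd unfolding order_at_scale_def by blast
  fix "is" :: "2 list"
  obtain C where "\<forall>\<delta>\<in>{0<..1}. \<forall>x\<in>cball 0 \<delta>. \<bar>pds (is @ [i]) (F \<delta>) x\<bar> \<le> C * \<delta> powr (k - length (is @ [i]))"
    using assms unfolding order_at_scale_def by blast
  then have "\<forall>\<delta>\<in>{0<..1}. \<forall>x\<in>cball 0 \<delta>. \<bar>pds is (pd i (F \<delta>)) x\<bar> \<le> C * \<delta> powr (k - 1 - length is)"
    by (simp add: pds_append algebra_simps)
  then show "\<exists>C. \<forall>\<delta>\<in>{0<..1}. \<forall>x\<in>cball 0 \<delta>. \<bar>pds is (pd i (F \<delta>)) x\<bar> \<le> C * \<delta> powr (k - 1 - length is)" ..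
qed

lemma order_at_scale_mult:
  assumes "order_at_scale k F" "order_at_scale l G"
  shows "order_at_scale (k + l) (\<lambda>\<delta> x. F \<delta> x * G \<delta> x)"
proof -
  have "\<exists>C. \<forall>\<delta>\<in>{0<..1}. \<forall>x\<in>cball 0 \<delta>. \<bar>pds is (\<lambda>x. F \<delta> x * G \<delta> x) x\<bar> \<le> C * \<delta> powr (k + l - length is)" for "is"
    using assms
  proof (induction "is" arbitrary: k l F G rule: rev_induct)
    case Nil
    have "\<exists>C. \<forall>\<delta>\<in>{0<..1}. \<forall>x\<in>cball 0 \<delta>. \<bar>F \<delta> x\<bar> \<le> C * \<delta> powr k"
      using Nil(1)[unfolded order_at_scale_def, THEN conjunct2, THEN spec[of _ "[]"]] by simp
    then obtain C where C: "\<And>\<delta> x. \<delta> \<in> {0<..1} \<Longrightarrow> x \<in> cball 0 \<delta> \<Longrightarrow> \<bar>F \<delta> x\<bar> \<le> C * \<delta> powr k"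
      by blast
    have "\<exists>D. \<forall>\<delta>\<in>{0<..1}. \<forall>x\<in>cball 0 \<delta>. \<bar>G \<delta> x\<bar> \<le> D * \<delta> powr l"
      using Nil(2)[unfolded order_at_scale_def, THEN conjunct2, THEN spec[of _ "[]"]] by simp
    then obtain D where D: "\<And>\<delta> x. \<delta> \<in> {0<..1} \<Longrightarrow> x \<in> cball 0 \<delta> \<Longrightarrow> \<bar>G \<delta> x\<bar> \<le> D * \<delta> powr l"
      by blast
    have "\<bar>F \<delta> x * G \<delta> x\<bar> \<le> C * D * \<delta> powr (k + l)" if "\<delta> \<in> {0<..1}" "x \<in> cball 0 \<delta>" for \<delta> x
    proof -
      have "\<bar>F \<delta> x\<bar> * \<bar>G \<delta> x\<bar> \<le> (C * \<delta> powr k) * (D * \<delta> powr l)"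
        using C[OF that] D[OF that] by (intro mult_mono) auto
      then show ?thesis by (simp add: abs_mult powr_add mult_ac)
    qed
    then show ?case by (intro exI[of _ "C * D"]) simp
  next
    case (snoc i "is")
    have sm: "smooth_on UNIV (F \<delta>)" "smooth_on UNIV (G \<delta>)" if "\<delta> \<in> {0<..1}" for \<delta>
      using snoc.prems that unfolding order_at_scale_def by auto
    obtain C where C: "\<forall>\<delta>\<in>{0<..1}. \<forall>x\<in>cball 0 \<delta>.
        \<bar>pds is (\<lambda>x. F \<delta> x * pd i (G \<delta>) x) x\<bar> \<le> C * \<delta> powr (k + (l - 1) - length is)"
      using snoc.IH[OF snoc.prems(1) order_at_scale_pd[OF snoc.prems(2)]] by blast
    obtain D where D: "\<forall>\<delta>\<in>{0<..1}. \<forall>x\<in>cball 0 \<delta>.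
        \<bar>pds is (\<lambda>x. pd i (F \<delta>) x * G \<delta> x) x\<bar> \<le> D * \<delta> powr (k - 1 + l - length is)"
      using snoc.IH[OF order_at_scale_pd[OF snoc.prems(1)] snoc.prems(2)] by blast
    have "\<bar>pds (is @ [i]) (\<lambda>x. F \<delta> x * G \<delta> x) x\<bar> \<le> (C + D) * \<delta> powr (k + l - length (is @ [i]))"
      if \<delta>: "\<delta> \<in> {0<..1}" and x: "x \<in> cball 0 \<delta>" for \<delta> x
    proof -
      have "pd i (\<lambda>x. F \<delta> x * G \<delta> x) = (\<lambda>x. F \<delta> x * pd i (G \<delta>) x + pd i (F \<delta>) x * G \<delta> x)"
        using pd_bilinear[OF bounded_bilinear_mult] smooth_on_differentiable[OF sm(1)[OF \<delta>]]
          smooth_on_differentiable[OF sm(2)[OF \<delta>]] by fastforce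
      then have "pds (is @ [i]) (\<lambda>x. F \<delta> x * G \<delta> x) x =
          pds is (\<lambda>x. F \<delta> x * pd i (G \<delta>) x) x + pds is (\<lambda>x. pd i (F \<delta>) x * G \<delta> x) x"
        using sm[OF \<delta>] by (simp add: pds_append pds_add smooth_on_mult smooth_on_pd)
      moreover have "\<bar>pds is (\<lambda>x. F \<delta> x * pd i (G \<delta>) x) x\<bar> \<le> C * \<delta> powr (k + l - length (is @ [i]))"
        using C[rule_format, OF \<delta> x] by (simp add: algebra_simps)
      moreover have "\<bar>pds is (\<lambda>x. pd i (F \<delta>) x * G \<delta> x) x\<bar> \<le> D * \<delta> powr (k + l - length (is @ [i]))"
        using D[rule_format, OF \<delta> x] by (simp add: algebra_simps)
      ultimately show ?thesis by (simp add: algebra_simps)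
    qed
    then show ?case by blast
  qed
  moreover have "\<forall>\<delta>\<in>{0<..1}. smooth_on UNIV (\<lambda>x. F \<delta> x * G \<delta> x)"
    using assms by (auto simp: order_at_scale_def intro: smooth_on_mult)
  ultimately show ?thesis unfolding order_at_scale_def by blast
qed

lemma order_at_scale_dilate:
  assumes "\<eta> \<in> test_functions U"
  shows "order_at_scale 0 (\<lambda>\<delta> x. \<eta> ((1 / \<delta>) *\<^sub>R x))"
  unfolding order_at_scale_def
proof (intro conjI allI ballI)
  note sm = test_functionsD(1)[OF assms]
  show "smooth_on UNIV (\<lambda>x. \<eta> ((1 / \<delta>) *\<^sub>R x))" for \<delta>
    using smooth_on_affine[OF sm, of _ 0] by simp
  fix "is" :: "2 list"
  have "pds is \<eta> \<in> test_functions U"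
    by (induction "is") (use assms test_functions_pd in auto)
  then obtain C where C: "\<And>x. \<bar>pds is \<eta> x\<bar> \<le> C"
    using test_function_bounded by (metis real_norm_def)
  have "\<bar>pds is (\<lambda>x. \<eta> ((1 / \<delta>) *\<^sub>R x)) x\<bar> \<le> C * \<delta> powr (0 - real (length is))" if "\<delta> \<in> {0<..1}" for \<delta> x
  proof -
    have "\<delta> powr (0 - real (length is)) = (1 / \<delta>) ^ length is"
      using that powr_minus[of \<delta> "real (length is)"] powr_realpow[of \<delta> "length is"]
      by (simp add: power_one_over inverse_eq_divide del: powr_realpow)
    moreover have "(1 / \<delta>) ^ length is * \<bar>pds is \<eta> ((1 / \<delta>) *\<^sub>R x)\<bar> \<le> (1 / \<delta>) ^ length is * C"
      using that by (intro mult_left_mono C) auto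
    ultimately show ?thesis
      using pds_affine[OF sm, of "is" "1 / \<delta>" 0] that by (simp add: abs_mult mult.commute)
  qed
  then show "\<exists>C. \<forall>\<delta>\<in>{0<..1}. \<forall>x\<in>cball 0 \<delta>. \<bar>pds is (\<lambda>x. \<eta> ((1 / \<delta>) *\<^sub>R x)) x\<bar> \<le> C * \<delta> powr (0 - real (length is))"
    by blast
qed

text \<open>Taylor's estimate, by integrating the bound on the derivatives of order \<open>N + 1\<close> back along
  segments from the origin.\<close>

lemma order_at_scale_vanishing:
  assumes \<phi>: "\<phi> \<in> test_functions U" and 0: "\<And>is. length is \<le> N \<Longrightarrow> pds is \<phi> 0 = 0"
  shows "order_at_scale (real N + 1) (\<lambda>\<delta>. \<phi>)"
  unfolding order_at_scale_def
proof (intro conjI allI)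
  note sm = test_functionsD(1)[OF \<phi>]
  show "\<forall>\<delta>\<in>{0<..1}. smooth_on UNIV \<phi>" using sm by blast
  have pds_tf: "pds is \<phi> \<in> test_functions U" for "is"
    by (induction "is") (use \<phi> test_functions_pd in auto)
  fix "is" :: "2 list"
  show "\<exists>C. \<forall>\<delta>\<in>{0<..1}. \<forall>x\<in>cball 0 \<delta>. \<bar>pds is \<phi> x\<bar> \<le> C * \<delta> powr (real N + 1 - real (length is))"
  proof (induction "N + 1 - length is" arbitrary: "is")
    case 0
    obtain C where C: "C > 0" "\<And>x. \<bar>pds is \<phi> x\<bar> \<le> C"
      using test_function_bounded[OF pds_tf] by (metis real_norm_def)
    have "\<bar>pds is \<phi> x\<bar> \<le> C * \<delta> powr (real N + 1 - real (length is))" if "\<delta> \<in> {0<..1}" for \<delta> x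
    proof -
      have "real N + 1 - real (length is) \<le> 0" using 0 by linarith
      then have "\<delta> powr 0 \<le> \<delta> powr (real N + 1 - real (length is))"
        using that by (intro powr_mono') auto
      then have "C * 1 \<le> C * \<delta> powr (real N + 1 - real (length is))"
        using C(1) that by (intro mult_left_mono) auto
      then show ?thesis using C(2)[of x] by linarith
    qed
    then show ?case by blast
  next
    case (Suc n)
    have "\<exists>C. \<forall>\<delta>\<in>{0<..1}. \<forall>x\<in>cball 0 \<delta>. \<bar>pds (i # is) \<phi> x\<bar> \<le> C * \<delta> powr (real N + 1 - real (length (i # is)))" for i
      using Suc(2) by (intro Suc(1)) simp
    then obtain C where C: "\<And>i \<delta> x. \<delta> \<in> {0<..1} \<Longrightarrow> x \<in> cball 0 \<delta> \<Longrightarrow>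
        \<bar>pds (i # is) \<phi> x\<bar> \<le> C i * \<delta> powr (real N + 1 - real (length (i # is)))"
      by metis
    define D where "D = max (C 1) (C 2)"
    have D: "C i \<le> D" for i using exhaust_2[of i] by (auto simp: D_def)
    have "\<bar>pds is \<phi> x\<bar> \<le> 2 * D * \<delta> powr (real N + 1 - real (length is))" if \<delta>: "\<delta> \<in> {0<..1}" and x: "x \<in> cball 0 \<delta>" for \<delta> x
    proof -
      let ?e = "real N - real (length is)"
      have bd: "\<bar>pd i (pds is \<phi>) y\<bar> \<le> D * \<delta> powr ?e" if "y \<in> cball 0 \<delta>" for i y
      proof -
        have "\<bar>pd i (pds is \<phi>) y\<bar> \<le> C i * \<delta> powr ?e" using C[OF \<delta> that, of i] by simp
        also have "\<dots> \<le> D * \<delta> powr ?e" using D by (intro mult_right_mono) auto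
        finally show ?thesis .
      qed
      have D0: "0 \<le> D * \<delta> powr ?e" using bd[of 0 1] \<delta> by fastforce
      have "norm (pds is \<phi> x - pds is \<phi> 0) \<le> 2 * (D * \<delta> powr ?e) * norm (x - 0)"
        using \<delta> x bd smooth_on_subset[OF test_functionsD(1)[OF pds_tf], of "cball 0 \<delta>"]
        by (intro smooth_on_lipschitz[of "cball 0 \<delta>"]) auto
      moreover have "pds is \<phi> 0 = 0" using Suc(2) by (intro assms(2)) simp
      ultimately have "\<bar>pds is \<phi> x\<bar> \<le> 2 * (D * \<delta> powr ?e) * norm x" by simp
      also have "\<dots> \<le> 2 * (D * \<delta> powr ?e) * \<delta>" using D0 x by (intro mult_left_mono) auto
      also have "\<dots> = 2 * D * (\<delta> powr ?e * \<delta> powr 1)" using \<delta> by simp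
      also have "\<dots> = 2 * D * \<delta> powr (?e + 1)" by (simp add: powr_add)
      finally show ?thesis by (simp add: algebra_simps)
    qed
    then show ?case by blast
  qed
qed

lemma cutoff_difference_test_function:
  fixes \<phi> \<eta> :: "real^2 \<Rightarrow> real"
  assumes "open \<Omega>" "\<phi> \<in> test_functions \<Omega>" "smooth_on UNIV \<eta>" "\<delta> > 0" "\<And>y. norm y < \<delta> \<Longrightarrow> \<eta> y = 1"
  shows "(\<lambda>x. \<phi> x - \<eta> x * \<phi> x) \<in> test_functions (\<Omega> - {0})"
proof (rule test_functionsI[of _ "supp \<phi> - ball 0 \<delta>"])
  show "smooth_on UNIV (\<lambda>x. \<phi> x - \<eta> x * \<phi> x)"
    using test_functionsD(1)[OF assms(2)] assms(3) by (intro smooth_on_diff smooth_on_mult) auto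
  show "\<phi> x - \<eta> x * \<phi> x = 0" if "x \<notin> supp \<phi> - ball 0 \<delta>" for x
    using that not_in_supp[of x \<phi>] assms(5)[of x] by auto
qed (use test_functionsD[OF assms(2)] assms(4) in \<open>auto intro: compact_diff\<close>)

text \<open>Cutting \<open>\<phi>\<close> off at scale \<open>\<delta>\<close> does not change \<open>T \<phi>\<close>, and if \<open>\<phi>\<close>
  vanishes to a higher order than that of \<open>T\<close>, all seminorms of the truncated function tend to zero
  with \<open>\<delta>\<close>.\<close>

lemma point_supported_finite_order:
  fixes T :: "(real^2 \<Rightarrow> real) \<Rightarrow> real"
  assumes \<Omega>: "open \<Omega>" "0 \<in> \<Omega>" and T: "distribution_on \<Omega> T"
    and T0: "\<And>\<phi>. \<phi> \<in> test_functions (\<Omega> - {0}) \<Longrightarrow> T \<phi> = 0"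
  obtains N where "\<And>\<phi>. \<phi> \<in> test_functions \<Omega> \<Longrightarrow> (\<And>is. length is \<le> N \<Longrightarrow> pds is \<phi> 0 = 0) \<Longrightarrow> T \<phi> = 0"
proof -
  obtain d where d: "d > 0" "cball 0 d \<subseteq> \<Omega>" using \<Omega> open_contains_cball by blast
  obtain C N where CN: "\<And>\<phi>. \<phi> \<in> test_functions \<Omega> \<Longrightarrow> supp \<phi> \<subseteq> cball 0 d \<Longrightarrow>
      \<bar>T \<phi>\<bar> \<le> C * (\<Sum>is | length is \<le> N. SUP x. norm (pds is \<phi> x))"
    using T d(2) unfolding distribution_on_def by (meson compact_cball)
  define \<eta> :: "real^2 \<Rightarrow> real" where "\<eta> = cutoff (1/4) 1"
  have \<eta>: "\<eta> \<in> test_functions UNIV" unfolding \<eta>_def by (rule cutoff_test_function) simp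
  have "T \<phi> = 0" if \<phi>: "\<phi> \<in> test_functions \<Omega>" and 0: "\<And>is. length is \<le> N \<Longrightarrow> pds is \<phi> 0 = 0" for \<phi> :: "real^2 \<Rightarrow> real"
  proof -
    define F where "F \<delta> x = \<eta> ((1 / \<delta>) *\<^sub>R x) * \<phi> x" for \<delta> x
    have "order_at_scale (0 + (real N + 1)) F"
      unfolding F_def by (intro order_at_scale_mult order_at_scale_dilate[OF \<eta>] order_at_scale_vanishing[OF \<phi> 0])
    then have "\<forall>is. \<exists>B. \<forall>\<delta>\<in>{0<..1}. \<forall>x\<in>cball 0 \<delta>. \<bar>pds is (F \<delta>) x\<bar> \<le> B * \<delta> powr (real N + 1 - length is)"
      by (simp add: order_at_scale_def)
    then obtain B where B: "\<And>is \<delta> x. \<delta> \<in> {0<..1} \<Longrightarrow> x \<in> cball 0 \<delta> \<Longrightarrow>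
        \<bar>pds is (F \<delta>) x\<bar> \<le> B is * \<delta> powr (real N + 1 - length is)"
      by metis
    have bound: "\<bar>T \<phi>\<bar> \<le> \<bar>C\<bar> * (\<Sum>is | length is \<le> N. \<bar>B is\<bar>) * \<delta>" if \<delta>: "0 < \<delta>" "\<delta> \<le> 1" "\<delta> \<le> d" for \<delta>
    proof -
      have sm: "smooth_on UNIV (\<lambda>x. \<eta> ((1 / \<delta>) *\<^sub>R x))"
        using smooth_on_affine[OF test_functionsD(1)[OF \<eta>], of "1 / \<delta>" 0] by simp
      have F: "F \<delta> \<in> test_functions \<Omega>"
        unfolding F_def using test_functions_mult[OF \<Omega>(1) \<phi> smooth_on_subset[OF sm]]
        by (simp add: mult.commute)
      have zero: "F \<delta> x = 0" if "x \<notin> cball 0 \<delta>" for x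
      proof -
        have "1 \<le> norm ((1 / \<delta>) *\<^sub>R x)" using \<delta> that by (simp add: not_le)
        then have "1 \<le> ((1 / \<delta>) *\<^sub>R x) \<bullet> ((1 / \<delta>) *\<^sub>R x)" by (metis one_le_power power2_norm_eq_inner)
        then show ?thesis unfolding F_def \<eta>_def by (subst cutoff_eq_0) auto
      qed
      then have supp: "supp (F \<delta>) \<subseteq> cball 0 \<delta>" by (intro supp_subsetI) auto
      have "(\<lambda>x. \<phi> x - \<eta> ((1 / \<delta>) *\<^sub>R x) * \<phi> x) \<in> test_functions (\<Omega> - {0})"
      proof (rule cutoff_difference_test_function[OF \<Omega>(1) \<phi> sm, of "\<delta> / 2"])
        fix y :: "real^2" assume "norm y < \<delta> / 2"
        then have "norm ((1 / \<delta>) *\<^sub>R y) \<le> 1 / 2" using \<delta> by (simp add: field_simps)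
        then have "(norm ((1 / \<delta>) *\<^sub>R y))\<^sup>2 \<le> (1 / 2)\<^sup>2" by (intro power_mono) auto
        then show "\<eta> ((1 / \<delta>) *\<^sub>R y) = 1"
          unfolding \<eta>_def by (intro cutoff_eq_1) (simp_all only: power2_norm_eq_inner, simp_all add: power2_eq_square)
      qed (use \<delta> in auto)
      then have "T (\<lambda>x. \<phi> x - F \<delta> x) = 0" using T0 by (simp add: F_def)
      then have "T \<phi> = T (F \<delta>)" using distribution_on_diff[OF T \<phi> F] by simp
      moreover have "\<bar>T (F \<delta>)\<bar> \<le> C * (\<Sum>is | length is \<le> N. SUP x. norm (pds is (F \<delta>) x))"
        using supp \<delta> by (intro CN[OF F]) auto
      moreover have "(SUP x. norm (pds is (F \<delta>) x)) \<le> \<bar>B is\<bar> * \<delta>" "0 \<le> (SUP x. norm (pds is (F \<delta>) x))"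
        if "length is \<le> N" for "is"
      proof -
        have le: "norm (pds is (F \<delta>) x) \<le> \<bar>B is\<bar> * \<delta>" for x
        proof (cases "x \<in> cball 0 \<delta>")
          case True
          have "\<delta> powr (real N + 1 - length is) \<le> \<delta> powr 1"
            using \<delta> that by (intro powr_mono') auto
          then have "B is * \<delta> powr (real N + 1 - length is) \<le> \<bar>B is\<bar> * \<delta>"
            using \<delta> by (intro mult_mono) auto
          then show ?thesis using B[of \<delta> x "is"] True \<delta> by simp
        next
          case False
          then have "x \<notin> supp (F \<delta>)" using supp by blast
          then show ?thesis using \<delta> by (simp add: pds_not_in_supp)
        qed
        show "(SUP x. norm (pds is (F \<delta>) x)) \<le> \<bar>B is\<bar> * \<delta>" by (rule cSUP_least) (use le in auto)
        have "bdd_above (range (\<lambda>x. norm (pds is (F \<delta>) x)))" by (rule bdd_aboveI2) (rule le)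
        then have "norm (pds is (F \<delta>) 0) \<le> (SUP x. norm (pds is (F \<delta>) x))" by (rule cSUP_upper[OF UNIV_I])
        then show "0 \<le> (SUP x. norm (pds is (F \<delta>) x))" using norm_ge_zero order_trans by blast
      qed
      then have "(\<Sum>is | length is \<le> N. SUP x. norm (pds is (F \<delta>) x)) \<le> (\<Sum>is | length is \<le> N. \<bar>B is\<bar> * \<delta>)"
        "0 \<le> (\<Sum>is | length is \<le> N. SUP x. norm (pds is (F \<delta>) x))"
        by (auto intro!: sum_mono sum_nonneg)
      then have "C * (\<Sum>is | length is \<le> N. SUP x. norm (pds is (F \<delta>) x)) \<le> \<bar>C\<bar> * (\<Sum>is | length is \<le> N. \<bar>B is\<bar> * \<delta>)"
        by (intro mult_mono) auto
      ultimately show ?thesis by (simp add: sum_distrib_right mult.assoc)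
    qed
    have "\<bar>T \<phi>\<bar> \<le> 0"
    proof (rule tendsto_lowerbound)
      let ?K = "\<bar>C\<bar> * (\<Sum>is | length is \<le> N. \<bar>B is\<bar>)"
      have "((\<lambda>\<delta>. ?K * \<delta>) \<longlongrightarrow> ?K * 0) (at_right 0)" by (intro tendsto_intros)
      then show "((\<lambda>\<delta>. ?K * \<delta>) \<longlongrightarrow> 0) (at_right 0)" by simp
      show "\<forall>\<^sub>F \<delta> in at_right 0. \<bar>T \<phi>\<bar> \<le> ?K * \<delta>"
        unfolding eventually_at_right_field
        by (rule exI[of _ "min 1 d"]) (use d bound in auto)
    qed simp
    then show ?thesis by simp
  qed
  then show ?thesis by (rule that)
qed

text \<open>If \<open>\<phi>\<close> vanishes to order \<open>m\<close>, then \<open>l\<^sup>m \<phi>(x/l)\<close> and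
  \<open>\<phi>\<close> have the same derivatives of order \<open>m\<close> at the origin. Their difference vanishes to a
  higher order, so by descending induction \<open>T\<close> does not distinguish them, and the scaling hypothesis
  says that \<open>T\<close> of the former tends to zero. This replaces the structure theorem for distributions
  supported at a point.\<close>

lemma point_supported_scaling:
  fixes T :: "(real^2 \<Rightarrow> real) \<Rightarrow> real"
  assumes \<Omega>: "open \<Omega>" and T: "distribution_on \<Omega> T"
    and T0: "\<And>\<phi>. \<phi> \<in> test_functions (\<Omega> - {0}) \<Longrightarrow> T \<phi> = 0"
    and r: "r > 0" "ball 0 r \<subseteq> \<Omega>"
    and scaling: "\<And>\<phi>. \<phi> \<in> test_functions (ball 0 r) \<Longrightarrow>
      ((\<lambda>l. l powr k * T (rescale l \<phi>)) \<longlongrightarrow> 0) (at_right 0)"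
    and k: "k \<le> real n + 2"
    and \<phi>: "\<phi> \<in> test_functions \<Omega>" "\<And>is. length is < n \<Longrightarrow> pds is \<phi> 0 = 0"
  shows "T \<phi> = 0"
proof -
  have "0 \<in> \<Omega>" using r by auto
  obtain N where N: "\<And>\<phi>. \<phi> \<in> test_functions \<Omega> \<Longrightarrow> (\<And>is. length is \<le> N \<Longrightarrow> pds is \<phi> 0 = 0) \<Longrightarrow> T \<phi> = 0"
    using point_supported_finite_order[OF \<Omega> \<open>0 \<in> \<Omega>\<close> T T0] by blast
  define Q where "Q m \<longleftrightarrow> (\<forall>\<phi>::real^2 \<Rightarrow> real. \<phi> \<in> test_functions (ball 0 r) \<longrightarrow> (\<forall>is. length is < m \<longrightarrow> pds is \<phi> 0 = 0) \<longrightarrow> T \<phi> = 0)" for m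
  have QD: "Q m \<Longrightarrow> \<phi> \<in> test_functions (ball 0 r) \<Longrightarrow> \<forall>is. length is < m \<longrightarrow> pds is \<phi> 0 = 0 \<Longrightarrow> T \<phi> = 0" for m \<phi>
    by (simp add: Q_def)
  have step: "Q m" if "n \<le> m" "Q (Suc m)" for m
    unfolding Q_def
  proof (intro allI impI)
    fix \<phi> :: "real^2 \<Rightarrow> real"
    assume \<phi>: "\<phi> \<in> test_functions (ball 0 r)" and 0: "\<forall>is. length is < m \<longrightarrow> pds is \<phi> 0 = 0"
    note sm = test_functionsD(1)[OF \<phi>]
    have eq: "T \<phi> = l powr (real m + 2) * T (rescale l \<phi>)" if l: "0 < l" "l < 1" for l
    proof -
      define \<psi> where "\<psi> x = \<phi> ((1 / l) *\<^sub>R x)" for x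
      have \<psi>: "\<psi> \<in> test_functions (ball 0 r)"
        unfolding \<psi>_def using test_functions_dilate[OF \<phi>] l by simp
      have \<psi>m: "(\<lambda>x. l ^ m * \<psi> x) \<in> test_functions (ball 0 r)"
        using test_functions_linear[OF bounded_linear_mult_right \<psi>] .
      note big = test_functions_mono[OF _ r(2)]
      have "T (\<lambda>x. l ^ m * \<psi> x - \<phi> x) = 0"
      proof (rule QD[OF \<open>Q (Suc m)\<close>])
        show "(\<lambda>x. l ^ m * \<psi> x - \<phi> x) \<in> test_functions (ball 0 r)"
          using test_functions_diff[OF \<psi>m \<phi>] .
        show "\<forall>is. length is < Suc m \<longrightarrow> pds is (\<lambda>x. l ^ m * \<psi> x - \<phi> x) 0 = 0"
        proof (intro allI impI)
          fix "is" :: "2 list" assume len: "length is < Suc m"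
          have "pds is \<psi> 0 = (1 / l) ^ length is * pds is \<phi> 0"
            using pds_affine[OF sm, of "is" "1 / l" 0] by (simp add: \<psi>_def[abs_def])
          then have "pds is (\<lambda>x. l ^ m * \<psi> x - \<phi> x) 0 = (l ^ m * (1 / l) ^ length is - 1) * pds is \<phi> 0"
            using pds_diff[OF test_functionsD(1)[OF \<psi>m] sm, of "is"]
              pds_linear[OF bounded_linear_mult_right test_functionsD(1)[OF \<psi>], of "is" "l ^ m"]
            by (simp add: algebra_simps)
          also have "\<dots> = 0"
          proof (cases "length is = m")
            case True
            then show ?thesis using l by (simp flip: power_mult_distrib)
          qed (use 0 len in auto)
          finally show "pds is (\<lambda>x. l ^ m * \<psi> x - \<phi> x) 0 = 0" .
        qed
      qed
      then have "T \<phi> = l ^ m * T \<psi>"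
        using distribution_on_diff[OF T big[OF \<psi>m] big[OF \<phi>]] distribution_on_scale[OF T big[OF \<psi>], of "l ^ m"] by simp
      moreover have "T (rescale l \<phi>) = (1 / l\<^sup>2) * T \<psi>"
        using distribution_on_scale[OF T big[OF \<psi>], of "1 / l\<^sup>2"] by (simp add: rescale_def[abs_def] \<psi>_def)
      moreover have "l powr (real m + 2) = l ^ m * l\<^sup>2"
        using l powr_realpow[of l "m + 2"] by (simp add: power_add power2_eq_square mult_ac add.commute)
      ultimately show ?thesis using l by simp
    qed
    have "\<bar>T \<phi>\<bar> \<le> 0"
    proof (rule tendsto_lowerbound)
      show "((\<lambda>l. \<bar>l powr k * T (rescale l \<phi>)\<bar>) \<longlongrightarrow> 0) (at_right 0)"
        using scaling[OF \<phi>] by (rule tendsto_rabs_zero)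
      have "\<bar>T \<phi>\<bar> \<le> \<bar>l powr k * T (rescale l \<phi>)\<bar>" if "0 < l" "l < 1" for l
      proof -
        have "l powr (real m + 2) \<le> l powr k" using that k \<open>n \<le> m\<close> by (intro powr_mono') auto
        then show ?thesis using eq[OF that] by (simp add: abs_mult mult_right_mono)
      qed
      then show "\<forall>\<^sub>F l in at_right 0. \<bar>T \<phi>\<bar> \<le> \<bar>l powr k * T (rescale l \<phi>)\<bar>"
        unfolding eventually_at_right_field by (intro exI[of _ 1]) auto
    qed simp
    then show "T \<phi> = 0" by simp
  qed
  have "Q (max n (Suc N))"
    unfolding Q_def using N test_functions_mono[OF _ r(2)] by (auto simp: less_max_iff_disj less_Suc_eq_le)
  then have Qn: "Q n"
    by (rule inc_induct[of n "max n (Suc N)", rotated]) (use step in auto)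
  define \<eta> :: "real^2 \<Rightarrow> real" where "\<eta> = cutoff (r\<^sup>2 / 16) (r\<^sup>2 / 4)"
  have \<eta>: "\<eta> \<in> test_functions (ball 0 r)"
    unfolding \<eta>_def by (rule cutoff_test_function) (use r in \<open>auto simp: real_sqrt_divide\<close>)
  have \<eta>1: "\<eta> y = 1" if "norm y < r / 4" for y
  proof -
    have "(norm y)\<^sup>2 \<le> (r / 4)\<^sup>2" using that by (intro power_mono) auto
    then show ?thesis
      unfolding \<eta>_def using r by (intro cutoff_eq_1) (auto simp: power2_norm_eq_inner power_divide)
  qed
  have \<eta>\<phi>: "(\<lambda>x. \<eta> x * \<phi> x) \<in> test_functions (ball 0 r)"
    using test_functions_mult[OF open_ball \<eta> smooth_on_subset[OF test_functionsD(1)[OF \<phi>(1)]]] by simp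
  have "T (\<lambda>x. \<phi> x - \<eta> x * \<phi> x) = 0"
    using r \<eta>1 by (intro T0 cutoff_difference_test_function[of _ _ _ "r / 4"] \<Omega> \<phi> test_functionsD(1)[OF \<eta>]) auto
  then have "T \<phi> = T (\<lambda>x. \<eta> x * \<phi> x)"
    using distribution_on_diff[OF T \<phi>(1) test_functions_mono[OF \<eta>\<phi> r(2)]] by simp
  also have "\<dots> = 0"
  proof (rule QD[OF Qn])
    show "\<forall>is. length is < n \<longrightarrow> pds is (\<lambda>x. \<eta> x * \<phi> x) 0 = 0"
    proof (intro allI impI)
      fix "is" :: "2 list" assume "length is < n"
      have "pds is (\<lambda>x. \<eta> x * \<phi> x) 0 = pds is \<phi> 0"
        by (rule pds_cong_open[of "ball 0 (r / 4)"]) (use \<eta>1 r in auto)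
      then show "pds is (\<lambda>x. \<eta> x * \<phi> x) 0 = 0" using \<phi>(2) \<open>length is < n\<close> by simp
    qed
  qed (rule \<eta>\<phi>)
  finally show ?thesis .
qed

section \<open>The incompatibility as a scalar distribution\<close>

text \<open>The tensor whose components are those of the stress with Airy stress function
  \<open>\<phi>\<close>; the incompatibility operator is its formal adjoint.\<close>

definition airy :: "(real^2 \<Rightarrow> real) \<Rightarrow> real^2 \<Rightarrow> real^2^2" where
  "airy \<phi> x = axis 1 (axis 1 (pd 2 (pd 2 \<phi>) x)) - axis 1 (axis 2 (pd 1 (pd 2 \<phi>) x))
    - (axis 2 (axis 1 (pd 2 (pd 1 \<phi>) x)) - axis 2 (axis 2 (pd 1 (pd 1 \<phi>) x)))"

lemma bounded_linear_axis2: "bounded_linear (\<lambda>c::real. axis i (axis j c) :: real^2^2)"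
proof -
  have "linear (\<lambda>c::real. axis i (axis j c) :: real^2^2)"
    by (intro linearI) (auto simp: vec_eq_iff axis_def)
  then show ?thesis by (simp add: linear_conv_bounded_linear)
qed

lemma norm_axis2: "norm (axis i (axis j c) :: real^2^2) = \<bar>c\<bar>"
  by (simp add: norm_eq_sqrt_inner inner_axis_axis)

lemma outer_axis: "(\<chi> k l. axis i 1 $ k * axis j c $ l) = (axis i (axis j c) :: real^2^2)"
  by (auto simp: vec_eq_iff axis_def)

lemma airy_parts:
  assumes "\<phi> \<in> test_functions U"
  shows "(\<lambda>x. axis i (axis j (pd k (pd l \<phi>) x)) :: real^2^2) \<in> test_functions U"
  using assms by (intro test_functions_linear[OF bounded_linear_axis2] test_functions_pd)

lemma airy_test_function: "\<phi> \<in> test_functions U \<Longrightarrow> airy \<phi> \<in> test_functions U"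
  unfolding airy_def[abs_def] by (intro test_functions_diff airy_parts)

lemma Curl_Curl_eq:
  assumes E: "distribution_on \<Omega> E" and \<phi>: "\<phi> \<in> test_functions \<Omega>"
  shows "Curl_vec (Curl_tensor E) \<phi> = E (airy \<phi>)"
proof -
  have nth: "(\<lambda>x. axis j (f x) $ i) = (if i = j then f else (\<lambda>x. 0 :: real))" for i j :: 2 and f :: "real^2 \<Rightarrow> real"
    by (auto simp: axis_def)
  have zero: "axis i (axis j 0) = (0 :: real^2^2)" for i j
    by (simp add: vec_eq_iff axis_def)
  note tf = airy_parts[OF \<phi>]
  show ?thesis
    unfolding airy_def[abs_def]
    using distribution_on_zero[OF E]
    by (simp add: distribution_on_diff[OF E] tf test_functions_diff
        Curl_vec_def dist_pd_def dist_comp_def Curl_tensor_def dist_transpose_apply_def sum_2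
        nth outer_axis zero)
qed

lemma airy_linear:
  assumes "\<phi> \<in> test_functions U" "\<psi> \<in> test_functions U"
  shows "airy (\<lambda>x. a * \<phi> x + b * \<psi> x) = (\<lambda>x. a *\<^sub>R airy \<phi> x + b *\<^sub>R airy \<psi> x)"
proof -
  note sm = test_functionsD(1)[OF assms(1)] test_functionsD(1)[OF assms(2)]
  have *: "smooth_on UNIV (\<lambda>x. c * f x)" if "smooth_on UNIV f" for c :: real and f :: "real^2 \<Rightarrow> real"
    by (rule smooth_on_linear[OF open_UNIV bounded_linear_mult_right that])
  have "pds is (\<lambda>x. a * \<phi> x + b * \<psi> x) = (\<lambda>x. a * pds is \<phi> x + b * pds is \<psi> x)" for "is"
    using sm by (simp add: pds_add * pds_linear[OF bounded_linear_mult_right])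
  from this[of "[_, _]"] show ?thesis
    by (auto simp: airy_def fun_eq_iff vec_eq_iff axis_def algebra_simps)
qed

text \<open>The two additional derivatives raise the order on each compact set by at most two.\<close>

lemma distribution_Curl_Curl:
  assumes E: "distribution_on \<Omega> E"
  shows "distribution_on \<Omega> (\<lambda>\<phi>. E (airy \<phi>))"
  unfolding distribution_on_def
proof (intro conjI ballI allI impI)
  fix \<phi> \<psi> :: "real^2 \<Rightarrow> real" and a b :: real
  assume tf: "\<phi> \<in> test_functions \<Omega>" "\<psi> \<in> test_functions \<Omega>"
  show "E (airy (\<lambda>x. a *\<^sub>R \<phi> x + b *\<^sub>R \<psi> x)) = a * E (airy \<phi>) + b * E (airy \<psi>)"
    using distribution_on_linear[OF E airy_test_function[OF tf(1)] airy_test_function[OF tf(2)]]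
    by (simp add: airy_linear[OF tf])
next
  fix K assume K: "compact K \<and> K \<subseteq> \<Omega>"
  obtain C N where CN: "\<And>\<Phi>. \<Phi> \<in> test_functions \<Omega> \<Longrightarrow> supp \<Phi> \<subseteq> K \<Longrightarrow>
      \<bar>E \<Phi>\<bar> \<le> C * (\<Sum>is | length is \<le> N. SUP x. norm (pds is \<Phi> x))"
    using E K unfolding distribution_on_def by meson
  have fin: "finite {is :: 2 list. length is \<le> n}" for n
    using finite_lists_length_le[of "UNIV :: 2 set" n] by simp
  let ?C = "\<bar>C\<bar> * (card {is :: 2 list. length is \<le> N} * 4)"
  have "\<bar>E (airy \<phi>)\<bar> \<le> ?C * (\<Sum>is | length is \<le> N + 2. SUP x. norm (pds is \<phi> x))"
    if \<phi>: "\<phi> \<in> test_functions \<Omega>" and supp: "supp \<phi> \<subseteq> K" for \<phi>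
  proof -
    define S where "S = (\<Sum>is | length is \<le> N + 2. SUP x. norm (pds is \<phi> x))"
    note sm = test_functionsD(1)[OF \<phi>]
    have pds_tf: "pds is \<phi> \<in> test_functions \<Omega>" for "is"
      by (induction "is") (use \<phi> test_functions_pd in auto)
    have bdd: "bdd_above (range (\<lambda>x. norm (pds is \<phi> x)))" for "is"
      using test_function_bounded[OF pds_tf[of "is"]] by (auto intro: bdd_aboveI2)
    have sup_nonneg: "0 \<le> (SUP x. norm (pds is \<phi> x))" for "is"
      using cSUP_upper[OF UNIV_I bdd[of "is"]] norm_ge_zero order_trans by blast
    have le_S: "norm (pds is \<phi> x) \<le> S" if "length is \<le> N + 2" for "is" x
    proof -
      have "norm (pds is \<phi> x) \<le> (SUP x. norm (pds is \<phi> x))"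
        by (rule cSUP_upper[OF UNIV_I bdd])
      also have "\<dots> \<le> S"
        unfolding S_def using that fin[of "N + 2"] sup_nonneg by (intro member_le_sum) auto
      finally show ?thesis .
    qed
    have "norm (pds is (airy \<phi>) x) \<le> 4 * S" if len: "length is \<le> N" for "is" x
    proof -
      let ?D = "\<lambda>i j k l. (\<lambda>x. axis i (axis j (pds [k, l] \<phi> x)) :: real^2^2)"
      have smD: "smooth_on UNIV (?D i j k l)" for i j k l
        using test_functionsD(1)[OF airy_parts[OF \<phi>]] by simp
      have "pds is (?D i j k l) = (\<lambda>x. axis i (axis j (pds (is @ [k, l]) \<phi> x)))" for i j k l
        using pds_linear[OF bounded_linear_axis2 smooth_on_pds[OF sm]] by (simp only: pds_append)
      then have bd: "norm (pds is (?D i j k l) x) \<le> S" for i j k l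
        using le_S[of "is @ [k, l]" x] len by (simp add: norm_axis2)
      have "pds is (airy \<phi>) x = pds is (?D 1 1 2 2) x - pds is (?D 1 2 1 2) x
          - (pds is (?D 2 1 2 1) x - pds is (?D 2 2 1 1) x)"
        unfolding airy_def[abs_def] using smD
        by (simp add: pds_diff smooth_on_diff)
      also have "norm \<dots> \<le> (S + S) + (S + S)"
        by (intro order_trans[OF norm_triangle_ineq4] add_mono bd)
      finally show ?thesis by simp
    qed
    then have "(SUP x. norm (pds is (airy \<phi>) x)) \<le> 4 * S" if "length is \<le> N" for "is"
      using that by (intro cSUP_least) auto
    then have "(\<Sum>is | length is \<le> N. SUP x. norm (pds is (airy \<phi>) x)) \<le> (\<Sum>is :: 2 list | length is \<le> N. 4 * S)"
      by (intro sum_mono) auto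
    moreover have "0 \<le> (SUP x. norm (pds is (airy \<phi>) x))" for "is"
    proof -
      have "pds is (airy \<phi>) \<in> test_functions \<Omega>"
        by (induction "is") (use airy_test_function[OF \<phi>] test_functions_pd in auto)
      from test_function_bounded[OF this]
      have "bdd_above (range (\<lambda>x. norm (pds is (airy \<phi>) x)))" by (auto intro: bdd_aboveI2)
      from cSUP_upper[OF UNIV_I this] show ?thesis using norm_ge_zero order_trans by blast
    qed
    ultimately have "C * (\<Sum>is | length is \<le> N. SUP x. norm (pds is (airy \<phi>) x))
        \<le> \<bar>C\<bar> * (\<Sum>is :: 2 list | length is \<le> N. 4 * S)"
      by (intro mult_mono) (auto intro: sum_nonneg)
    moreover have "supp (airy \<phi>) \<subseteq> K"
    proof (rule order_trans[OF supp_subsetI[OF closed_supp[of \<phi>]] supp])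
      show "airy \<phi> x = 0" if "x \<notin> supp \<phi>" for x
        using pds_not_in_supp[OF that, of "[_, _]"] by (simp add: airy_def axis_def vec_eq_iff)
    qed
    ultimately show ?thesis
      using CN[OF airy_test_function[OF \<phi>]] by (simp add: S_def mult_ac)
  qed
  then show "\<exists>C N. \<forall>\<phi>\<in>test_functions \<Omega>. supp \<phi> \<subseteq> K \<longrightarrow>
      \<bar>E (airy \<phi>)\<bar> \<le> C * (\<Sum>is | length is \<le> N. SUP x. norm (pds is \<phi> x))"
    by blast
qed

lemma airy_rescale:
  assumes "\<phi> \<in> test_functions U"
  shows "airy (rescale l \<phi>) = (\<lambda>x. (1 / l\<^sup>2) *\<^sub>R rescale l (airy \<phi>) x)"
proof -
  have sm: "smooth_on UNIV \<phi>" using test_functionsD(1)[OF assms] .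
  then have sm': "smooth_on UNIV (\<lambda>x. \<phi> ((1 / l) *\<^sub>R x))" using smooth_on_affine[of \<phi> "1 / l" 0] by simp
  have "pds is (rescale l \<phi>) x = (1 / l\<^sup>2) * ((1 / l) ^ length is * pds is \<phi> ((1 / l) *\<^sub>R x))" for "is" x
    using pds_linear[OF bounded_linear_mult_right sm', of "is" "1 / l\<^sup>2"] pds_affine[OF sm, of "is" "1 / l" 0]
    by (simp add: rescale_def[abs_def])
  from this[of "[_, _]"] show ?thesis
    by (auto simp: airy_def rescale_def fun_eq_iff vec_eq_iff axis_def algebra_simps power2_eq_square)
qed

section \<open>Classical incompatibility and the affine test functions\<close>

lemma curl_tensor_nth:
  "curl_tensor M x $ i = pd 1 (\<lambda>y. M y $ i $ 2) x - pd 2 (\<lambda>y. M y $ i $ 1) x"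
proof -
  have "(transpose (M y) *v axis i 1) $ j = M y $ i $ j" for y j
    by (simp add: matrix_vector_mult_basis column_def transpose_def)
  then show ?thesis by (simp add: curl_tensor_def curl_vec_def)
qed

lemma smooth_on_entry:
  fixes M :: "real^2 \<Rightarrow> real^2^2"
  assumes "open U" "smooth_on U M"
  shows "smooth_on U (\<lambda>x. M x $ i $ j)"
proof -
  have "bounded_linear (\<lambda>A::real^2^2. A $ i $ j)"
    by (rule bounded_linear_compose[OF bounded_linear_vec_nth bounded_linear_vec_nth])
  then show ?thesis using smooth_on_linear assms by blast
qed

lemma smooth_on_curl_tensor:
  assumes "open U" "smooth_on U M"
  shows "smooth_on U (\<lambda>x. curl_tensor M x $ i)"
  unfolding curl_tensor_nth
  by (intro smooth_on_diff smooth_on_pd smooth_on_entry assms)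

lemma smooth_on_curl_curl:
  assumes "open U" "smooth_on U M"
  shows "smooth_on U (curl_vec (curl_tensor M))"
  unfolding curl_vec_def[abs_def]
  by (intro smooth_on_diff smooth_on_pd smooth_on_curl_tensor assms)

lemma integral_test_times_smooth:
  fixes f g :: "real^2 \<Rightarrow> real"
  assumes "open U" "smooth_on U f" "g \<in> test_functions U"
  shows "integrable lborel (\<lambda>x. f x * g x)"
  using integrable_test_function[OF test_functions_mult[OF assms(1,3,2)]] by (simp add: mult.commute)

lemma inner_airy:
  "M \<bullet> airy \<phi> x = M $ 1 $ 1 * pd 2 (pd 2 \<phi>) x - M $ 1 $ 2 * pd 1 (pd 2 \<phi>) x
    - M $ 2 $ 1 * pd 2 (pd 1 \<phi>) x + M $ 2 $ 2 * pd 1 (pd 1 \<phi>) x"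
  by (simp add: airy_def inner_diff_right inner_axis)

text \<open>This is used for \<open>\<psi>\<close> the rotated gradient of a test function, or that part of the rotated
  gradient of a truncated affine function which stays away from the origin.\<close>

lemma integral_curl_by_parts:
  assumes U: "open U" and M: "smooth_on U M" and \<psi>: "\<psi>1 \<in> test_functions U" "\<psi>2 \<in> test_functions U"
  shows "(LINT x|lborel. (M x $ 1 $ 2 * pd 1 \<psi>1 x - M x $ 1 $ 1 * pd 2 \<psi>1 x)
      + (M x $ 2 $ 2 * pd 1 \<psi>2 x - M x $ 2 $ 1 * pd 2 \<psi>2 x))
    = - (LINT x|lborel. curl_tensor M x $ 1 * \<psi>1 x + curl_tensor M x $ 2 * \<psi>2 x)"
proof -
  note sm = smooth_on_entry[OF U M]
  note int = integral_test_times_smooth[OF U sm test_functions_pd[OF \<psi>(1)]]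
    integral_test_times_smooth[OF U sm test_functions_pd[OF \<psi>(2)]]
    integral_test_times_smooth[OF U smooth_on_pd[OF sm] \<psi>(1)]
    integral_test_times_smooth[OF U smooth_on_pd[OF sm] \<psi>(2)]
  show ?thesis
    using int
    by (simp add: curl_tensor_nth left_diff_distrib integral_by_parts[OF U sm \<psi>(1)] integral_by_parts[OF U sm \<psi>(2)])
qed

lemma integral_airy:
  assumes U: "open U" and M: "smooth_on U M" and \<phi>: "\<phi> \<in> test_functions U"
  shows "(LINT x|lborel. M x \<bullet> airy \<phi> x) = (LINT x|lborel. curl_vec (curl_tensor M) x * \<phi> x)"
proof -
  note neg = test_functions_linear[OF bounded_linear_minus[OF bounded_linear_ident]]
  have pd_neg: "pd i (\<lambda>x. - pd 2 \<phi> x) x = - pd i (pd 2 \<phi>) x" for i x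
    using pd_linear[OF bounded_linear_minus[OF bounded_linear_ident]]
      smooth_on_differentiable[OF test_functionsD(1)[OF test_functions_pd[OF \<phi>]]] by blast
  have "(LINT x|lborel. M x \<bullet> airy \<phi> x) =
      (LINT x|lborel. (M x $ 1 $ 2 * pd 1 (\<lambda>x. - pd 2 \<phi> x) x - M x $ 1 $ 1 * pd 2 (\<lambda>x. - pd 2 \<phi> x) x)
      + (M x $ 2 $ 2 * pd 1 (pd 1 \<phi>) x - M x $ 2 $ 1 * pd 2 (pd 1 \<phi>) x))"
    by (simp add: inner_airy pd_neg algebra_simps)
  also have "\<dots> = - (LINT x|lborel. curl_tensor M x $ 1 * - pd 2 \<phi> x + curl_tensor M x $ 2 * pd 1 \<phi> x)"
    by (rule integral_curl_by_parts[OF U M neg[OF test_functions_pd[OF \<phi>]] test_functions_pd[OF \<phi>]])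
  also have "\<dots> = (LINT x|lborel. curl_tensor M x $ 1 * pd 2 \<phi> x) - (LINT x|lborel. curl_tensor M x $ 2 * pd 1 \<phi> x)"
    using integral_test_times_smooth[OF U smooth_on_curl_tensor[OF U M] test_functions_pd[OF \<phi>]] by simp
  also have "\<dots> = (LINT x|lborel. curl_vec (curl_tensor M) x * \<phi> x)"
    using integral_test_times_smooth[OF U smooth_on_pd[OF smooth_on_curl_tensor[OF U M]] \<phi>]
    by (simp add: curl_vec_def left_diff_distrib integral_by_parts[OF U smooth_on_curl_tensor[OF U M] \<phi>])
  finally show ?thesis .
qed

definition affine_fun :: "real \<Rightarrow> real^2 \<Rightarrow> real^2 \<Rightarrow> real" where
  "affine_fun c b y = c + b \<bullet> y"

text \<open>For the affine function \<open>a(y) = c + b \<bullet> y\<close> this is \<open>M\<^sup>T w - a curl M\<close>, where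
  \<open>w = (- b\<^sub>2, b\<^sub>1)\<close> is the rotated gradient of \<open>a\<close>. It is curl-free when
  \<open>curl curl M = 0\<close>, and its circulations are linear combinations of the line integrals of
  \<open>M\<close>, \<open>curl M\<close> and the first moments of \<open>curl M\<close>.\<close>

definition moment_field :: "(real^2 \<Rightarrow> real^2^2) \<Rightarrow> real \<Rightarrow> real^2 \<Rightarrow> 2 \<Rightarrow> real^2 \<Rightarrow> real" where
  "moment_field M c b j y =
    b $ 1 * M y $ 2 $ j - b $ 2 * M y $ 1 $ j - affine_fun c b y * curl_tensor M y $ j"

lemma affine_fun_derivative: "(affine_fun c b has_derivative (\<lambda>h. b \<bullet> h)) (at x)"
  unfolding affine_fun_def[abs_def] by (auto intro!: derivative_eq_intros)

lemma pd_affine_fun: "pd i (affine_fun c b) x = b $ i"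
  using pd_eqI[OF affine_fun_derivative] by (simp add: inner_axis)

lemma smooth_on_affine_fun: "smooth_on S (affine_fun c b)"
proof -
  have "smooth_on UNIV (\<lambda>y. c + b \<bullet> y)"
    by (intro smooth_on_add smooth_on_const smooth_on_vec_linear bounded_linear_inner_right open_UNIV)
  then have "smooth_on UNIV (affine_fun c b)" by (simp add: affine_fun_def[abs_def])
  then show ?thesis by (rule smooth_on_subset) simp
qed

lemma smooth_on_moment_field:
  assumes U: "open U" and M: "smooth_on U M"
  shows "smooth_on U (moment_field M c b j)"
  unfolding moment_field_def[abs_def]
  by (intro smooth_on_diff smooth_on_mult smooth_on_const smooth_on_entry smooth_on_affine_fun
      smooth_on_curl_tensor assms)

lemma curl_moment_field:
  assumes U: "open U" and M: "smooth_on U M" and x: "x \<in> U"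
  shows "pd 1 (moment_field M c b 2) x - pd 2 (moment_field M c b 1) x
    = - (affine_fun c b x * curl_vec (curl_tensor M) x)"
proof -
  let ?a = "affine_fun c b"
  have da: "(?a has_derivative (\<lambda>h. b \<bullet> h)) (at x)" by (rule affine_fun_derivative)
  have pd_mf: "pd i (moment_field M c b j) x = b $ 1 * pd i (\<lambda>y. M y $ 2 $ j) x - b $ 2 * pd i (\<lambda>y. M y $ 1 $ j) x
      - (?a x * pd i (\<lambda>y. curl_tensor M y $ j) x + b $ i * curl_tensor M x $ j)" for i j
  proof -
    obtain D1 D2 D3 where D: "((\<lambda>y. M y $ 1 $ j) has_derivative D1) (at x)" "((\<lambda>y. M y $ 2 $ j) has_derivative D2) (at x)"
      "((\<lambda>y. curl_tensor M y $ j) has_derivative D3) (at x)"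
      using smooth_on_differentiable[OF smooth_on_entry[OF U M] x]
        smooth_on_differentiable[OF smooth_on_curl_tensor[OF U M] x] unfolding differentiable_def by metis
    have "(moment_field M c b j has_derivative (\<lambda>h. b $ 1 * D2 h - b $ 2 * D1 h - (?a x * D3 h + (b \<bullet> h) * curl_tensor M x $ j))) (at x)"
      unfolding moment_field_def[abs_def]
      by (auto intro!: derivative_eq_intros D da)
    from pd_eqI[OF this, of i] show ?thesis
      using pd_eqI[OF D(1), of i] pd_eqI[OF D(2), of i] pd_eqI[OF D(3), of i] by (simp add: inner_axis)
  qed
  show ?thesis
    by (simp only: curl_vec_def pd_mf) (simp add: curl_tensor_nth[of M x] algebra_simps)
qed

text \<open>Near the origin the product of the cutoff with an affine function \<open>a\<close> is affine, so its Airy tensor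
  lives on an annulus and only sees the smooth field. In the rotated gradient of the product, the part
  with the gradient of the cutoff is a test function on the annulus, and integration by parts turns it
  into the term with \<open>curl M\<close>.\<close>

lemma airy_cutoff_affine:
  fixes c :: real and b :: "real^2"
  assumes U: "open U" "cball 0 R - {0} \<subseteq> U" and M: "smooth_on U M" and a: "0 < \<alpha>" "\<alpha> < R\<^sup>2" "R > 0"
  defines "\<phi> \<equiv> (\<lambda>y. cutoff \<alpha> (R\<^sup>2) y * affine_fun c b y)"
  shows "airy \<phi> \<in> test_functions U"
    and "(LINT x|lborel. M x \<bullet> airy \<phi> x) =
      (LINT x|lborel. moment_field M c b 2 x * pd 1 (cutoff \<alpha> (R\<^sup>2)) x - moment_field M c b 1 x * pd 2 (cutoff \<alpha> (R\<^sup>2)) x)"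
proof -
  let ?h = "cutoff \<alpha> (R\<^sup>2)" and ?a = "affine_fun c b"
  have pdh: "pd i ?h \<in> test_functions U" for i
    using pd_cutoff_test_function[OF U a] .
  have smh: "smooth_on UNIV ?h" by (rule smooth_on_cutoff)
  have pd_\<phi>: "pd i \<phi> = (\<lambda>x. ?h x * b $ i + pd i ?h x * ?a x)" for i
    unfolding \<phi>_def using pd_bilinear[OF bounded_bilinear_mult, of ?h _ ?a i]
      smooth_on_differentiable[OF smh] smooth_on_differentiable[OF smooth_on_affine_fun[of UNIV]]
    by (simp add: pd_affine_fun fun_eq_iff)
  have tfa: "(\<lambda>x. pd j ?h x * ?a x) \<in> test_functions U" for j
    by (intro test_functions_mult pdh smooth_on_affine_fun U)
  have dtfa: "(\<lambda>x. pd j ?h x * ?a x) differentiable (at x)" for j x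
    using smooth_on_differentiable[OF test_functionsD(1)[OF tfa]] by simp
  have pd2_\<phi>: "pd i (pd j \<phi>) x = b $ j * pd i ?h x + pd i (\<lambda>x. pd j ?h x * ?a x) x" for i j x
  proof -
    have lin: "bounded_linear (\<lambda>t::real. t * b $ j)" by (rule bounded_linear_mult_left)
    have dh: "?h differentiable (at x)" using smooth_on_differentiable[OF smh] by simp
    show ?thesis
      unfolding pd_\<phi>
      using pd_add[OF differentiable_linear[OF lin dh] dtfa, of i j] pd_linear[OF lin dh, of i] by simp
  qed
  have sm2: "pd i (pd j \<phi>) \<in> test_functions U" for i j
    unfolding pd2_\<phi>[abs_def]
    by (intro test_functions_add test_functions_linear[OF bounded_linear_mult_right] pdh test_functions_pd tfa)
  show "airy \<phi> \<in> test_functions U"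
    unfolding airy_def[abs_def] by (intro test_functions_diff test_functions_linear[OF bounded_linear_axis2] sm2)
  note neg = test_functions_linear[OF bounded_linear_minus[OF bounded_linear_ident]]
  let ?p1 = "\<lambda>x. - (pd 2 ?h x * ?a x)" and ?p2 = "\<lambda>x. pd 1 ?h x * ?a x"
  have pd_neg: "pd i ?p1 x = - pd i (\<lambda>x. pd 2 ?h x * ?a x) x" for i x
    using pd_linear[OF bounded_linear_minus[OF bounded_linear_ident] dtfa] .
  have int: "integrable lborel (\<lambda>x. f x * g x)" if "smooth_on U f" "g \<in> test_functions U" for f g :: "real^2 \<Rightarrow> real"
    using integral_test_times_smooth[OF U(1) that] .
  note ent = smooth_on_entry[OF U(1) M] and crl = smooth_on_curl_tensor[OF U(1) M]
  define L where "L x = (M x $ 1 $ 2 * pd 1 ?p1 x - M x $ 1 $ 1 * pd 2 ?p1 x)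
      + (M x $ 2 $ 2 * pd 1 ?p2 x - M x $ 2 $ 1 * pd 2 ?p2 x)" for x
  define Q where "Q x = (b $ 1 * M x $ 2 $ 2 - b $ 2 * M x $ 1 $ 2) * pd 1 ?h x
      - (b $ 1 * M x $ 2 $ 1 - b $ 2 * M x $ 1 $ 1) * pd 2 ?h x" for x
  define P where "P x = curl_tensor M x $ 1 * ?p1 x + curl_tensor M x $ 2 * ?p2 x" for x
  have intL: "integrable lborel L"
    unfolding L_def by (intro Bochner_Integration.integrable_add Bochner_Integration.integrable_diff
        int ent test_functions_pd neg tfa)
  have intP: "integrable lborel P"
    unfolding P_def by (intro Bochner_Integration.integrable_add int crl neg tfa)
  have intQ: "integrable lborel Q"
    unfolding Q_def
    by (intro Bochner_Integration.integrable_diff int smooth_on_diff smooth_on_mult smooth_on_const ent pdh U)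
  have "(LINT x|lborel. M x \<bullet> airy \<phi> x) = (LINT x|lborel. L x + Q x)"
    by (rule Bochner_Integration.integral_cong[OF refl])
      (simp only: L_def Q_def inner_airy pd2_\<phi> pd_neg, simp only: algebra_simps)
  also have "\<dots> = (LINT x|lborel. L x) + (LINT x|lborel. Q x)" using intL intQ by simp
  also have "(LINT x|lborel. L x) = - (LINT x|lborel. P x)"
    unfolding L_def P_def by (rule integral_curl_by_parts[OF U(1) M neg[OF tfa] tfa])
  also have "- (LINT x|lborel. P x) + (LINT x|lborel. Q x) = (LINT x|lborel. Q x - P x)"
    using intP intQ by simp
  also have "\<dots> = (LINT x|lborel. moment_field M c b 2 x * pd 1 ?h x - moment_field M c b 1 x * pd 2 ?h x)"
    by (rule Bochner_Integration.integral_cong[OF refl])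
      (simp add: P_def Q_def moment_field_def algebra_simps)
  finally show "(LINT x|lborel. M x \<bullet> airy \<phi> x) =
      (LINT x|lborel. moment_field M c b 2 x * pd 1 ?h x - moment_field M c b 1 x * pd 2 ?h x)" .
qed

text \<open>The contraction of \<open>(y - x) \<times> e\<^sub>3\<close> with \<open>e\<^sub>1\<close> is \<open>- a(y)\<close> for \<open>a(y) = x\<^sub>2 - y\<^sub>2\<close>,
  with \<open>e\<^sub>2\<close> it is \<open>- a(y)\<close> for \<open>a(y) = y\<^sub>1 - x\<^sub>1\<close>; in both cases the rotated gradient of
  \<open>a\<close> is the basis vector itself.\<close>

lemma circle_integral_nth:
  assumes U: "open U" "cball 0 \<epsilon> - {0} \<subseteq> U" and M: "smooth_on U M" and \<epsilon>: "\<epsilon> > 0"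
  shows "circle_integral M \<epsilon> x $ 1 = circulation (moment_field M (x $ 2) (- axis 2 1) 1) (moment_field M (x $ 2) (- axis 2 1) 2) \<epsilon>"
    and "circle_integral M \<epsilon> x $ 2 = circulation (moment_field M (- x $ 1) (axis 1 1) 1) (moment_field M (- x $ 1) (axis 1 1) 2) \<epsilon>"
proof -
  define f where "f t = (let y = vector [\<epsilon> * cos t, \<epsilon> * sin t];
          dy = vector [- \<epsilon> * sin t, \<epsilon> * cos t]
      in M y *v dy + (curl_tensor M y \<bullet> dy) *\<^sub>R cross_e3 (y - x))" for t
  have circ: "vector [\<epsilon> * cos t, \<epsilon> * sin t] = \<epsilon> *\<^sub>R circ t" for t
    by (simp add: vec_eq_iff forall_2)
  have mv: "(A *v v) $ i = A $ i $ 1 * v $ 1 + A $ i $ 2 * v $ 2" for A :: "real^2^2" and v i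
    by (simp add: matrix_vector_mult_def sum_2)
  have f1: "f t $ 1 = \<epsilon> * (cos t * moment_field M (x $ 2) (- axis 2 1) 2 (\<epsilon> *\<^sub>R circ t)
      - sin t * moment_field M (x $ 2) (- axis 2 1) 1 (\<epsilon> *\<^sub>R circ t))" for t
    by (simp add: f_def Let_def circ mv cross_e3_def moment_field_def affine_fun_def inner_vec_2 axis_def algebra_simps)
  have f2: "f t $ 2 = \<epsilon> * (cos t * moment_field M (- x $ 1) (axis 1 1) 2 (\<epsilon> *\<^sub>R circ t)
      - sin t * moment_field M (- x $ 1) (axis 1 1) 1 (\<epsilon> *\<^sub>R circ t))" for t
    by (simp add: f_def Let_def circ mv cross_e3_def moment_field_def affine_fun_def inner_vec_2 axis_def algebra_simps)
  have inU: "\<epsilon> *\<^sub>R circ t \<in> U" for t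
  proof -
    have "norm (\<epsilon> *\<^sub>R circ t) = \<epsilon>" using \<epsilon> by simp
    then have "\<epsilon> *\<^sub>R circ t \<in> cball 0 \<epsilon> - {0}" using \<epsilon> by (auto simp del: norm_scaleR)
    then show ?thesis using U(2) by auto
  qed
  have cont: "continuous_on S (\<lambda>t. moment_field M c b j (\<epsilon> *\<^sub>R circ t))" for S c b j
    by (intro continuous_on_compose2[OF smooth_on_continuous_on[OF smooth_on_moment_field[OF U(1) M]]] continuous_intros)
      (use inU in auto)
  have "f t = (f t $ 1) *\<^sub>R axis 1 1 + (f t $ 2) *\<^sub>R axis 2 1" for t
    by (simp add: vec_eq_iff forall_2 axis_def)
  then have "f = (\<lambda>t. (f t $ 1) *\<^sub>R axis 1 1 + (f t $ 2) *\<^sub>R axis 2 1)" by (rule ext)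
  moreover have "continuous_on {0..2 * pi} (\<lambda>t. (f t $ 1) *\<^sub>R axis 1 1 + (f t $ 2) *\<^sub>R axis 2 1 :: real^2)"
    unfolding f1 f2 by (intro continuous_intros cont)
  ultimately have "f integrable_on {0..2 * pi}" using integrable_continuous_real by metis
  then have int: "integral {0..2 * pi} f $ i = integral {0..2 * pi} (\<lambda>t. f t $ i)" for i
    by (rule integral_component_eq_cart[symmetric])
  have eq: "circle_integral M \<epsilon> x = integral {0..2 * pi} f"
    unfolding circle_integral_def f_def[abs_def] ..
  show "circle_integral M \<epsilon> x $ 1 = circulation (moment_field M (x $ 2) (- axis 2 1) 1) (moment_field M (x $ 2) (- axis 2 1) 2) \<epsilon>"
    unfolding eq int f1 circulation_def ..
  show "circle_integral M \<epsilon> x $ 2 = circulation (moment_field M (- x $ 1) (axis 1 1) 1) (moment_field M (- x $ 1) (axis 1 1) 2) \<epsilon>"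
    unfolding eq int f2 circulation_def ..
qed

section \<open>The compatibility condition\<close>

lemma given_by_integral:
  assumes "given_by U T f" "\<Phi> \<in> test_functions U"
  shows "T \<Phi> = (LINT x|lborel. f x \<bullet> \<Phi> x)"
proof -
  have "indicator U x *\<^sub>R (f x \<bullet> \<Phi> x) = f x \<bullet> \<Phi> x" for x :: "real^2"
    using subsetD[OF test_functionsD(3)[OF assms(2)], of x] not_in_supp[of x \<Phi>]
    by (cases "x \<in> supp \<Phi>") simp_all
  then have "(\<lambda>x. indicator U x *\<^sub>R (f x \<bullet> \<Phi> x)) = (\<lambda>x. f x \<bullet> \<Phi> x)" by (rule ext)
  moreover have "T \<Phi> = (LINT x|lborel. indicator U x *\<^sub>R (f x \<bullet> \<Phi> x))"
    using assms by (simp add: given_by_def set_lebesgue_integral_def)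
  ultimately show ?thesis by simp
qed

text \<open>Two derivatives raise the scaling degree by at most two, because each of them brings a factor
  \<open>1 / l\<close> out of the rescaled test function.\<close>

lemma scaling_degree_Curl_Curl:
  assumes E: "distribution_on \<Omega> E" and r: "ball 0 r \<subseteq> \<Omega>" and sd: "scaling_degree r E < ereal s"
  obtains k where "k < s + 2" "\<And>\<phi>. \<phi> \<in> test_functions (ball 0 r) \<Longrightarrow>
    ((\<lambda>l. l powr k * E (airy (rescale l \<phi>))) \<longlongrightarrow> 0) (at_right 0)"
proof -
  obtain k where k: "k < s" and lim: "\<And>\<Phi>. \<Phi> \<in> test_functions (ball 0 r) \<Longrightarrow>
      ((\<lambda>l. l powr k * E (rescale l \<Phi>)) \<longlongrightarrow> 0) (at_right 0)"
    using sd unfolding scaling_degree_def Inf_less_iff by auto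
  have "((\<lambda>l. l powr (k + 2) * E (airy (rescale l \<phi>))) \<longlongrightarrow> 0) (at_right 0)"
    if \<phi>: "\<phi> \<in> test_functions (ball 0 r)" for \<phi>
  proof (rule Lim_transform_eventually[OF lim[OF airy_test_function[OF \<phi>]]])
    have "l powr k * E (rescale l (airy \<phi>)) = l powr (k + 2) * E (airy (rescale l \<phi>))" if l: "0 < l" "l < 1" for l
    proof -
      have "rescale l (airy \<phi>) \<in> test_functions (ball 0 r)"
        unfolding rescale_def[abs_def] using l
        by (intro test_functions_linear[OF bounded_linear_scaleR_right] test_functions_dilate airy_test_function \<phi>) auto
      then have "E (airy (rescale l \<phi>)) = (1 / l\<^sup>2) * E (rescale l (airy \<phi>))"
        using distribution_on_scale[OF E test_functions_mono[OF _ r]] by (simp add: airy_rescale[OF \<phi>])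
      moreover have "l powr (k + 2) = l powr k * l\<^sup>2"
        using l powr_realpow[of l 2] by (simp add: powr_add)
      ultimately show ?thesis using l by simp
    qed
    then show "\<forall>\<^sub>F l in at_right 0. l powr k * E (rescale l (airy \<phi>)) = l powr (k + 2) * E (airy (rescale l \<phi>))"
      unfolding eventually_at_right_field by (intro exI[of _ 1]) auto
  qed
  with k show ?thesis by (intro that[of "k + 2"]) auto
qed

lemma Curl_Curl_test_integral:
  assumes "open U" "smooth_on U E0" "given_by U E E0" "\<phi> \<in> test_functions U"
  shows "E (airy \<phi>) = (LINT x|lborel. curl_vec (curl_tensor E0) x * \<phi> x)"
  using given_by_integral[OF assms(3) airy_test_function[OF assms(4)]] integral_airy[OF assms(1,2,4)]
  by simp

text \<open>The link between the distribution and the line integrals: the multiplicity of the delta distribution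
  and of its first derivatives in \<open>Curl Curl E\<close> is measured by truncated affine functions, and
  their values are circulations.\<close>

lemma Curl_Curl_cutoff_affine:
  assumes U: "open U" "cball 0 \<epsilon> - {0} \<subseteq> U" and E0: "smooth_on U E0" "given_by U E E0"
    and \<epsilon>: "\<epsilon> > 0" and curl: "\<And>x. x \<in> U \<Longrightarrow> curl_vec (curl_tensor E0) x = 0"
  shows "E (airy (\<lambda>y. cutoff (\<epsilon>\<^sup>2 / 2) (\<epsilon>\<^sup>2) y * affine_fun c b y)) =
    cutoff_weight (\<epsilon>\<^sup>2 / 2) (\<epsilon>\<^sup>2) * circulation (moment_field E0 c b 1) (moment_field E0 c b 2) \<epsilon>"
proof -
  have a: "0 < \<epsilon>\<^sup>2 / 2" "\<epsilon>\<^sup>2 / 2 < \<epsilon>\<^sup>2" using \<epsilon> by auto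
  have "pd 1 (moment_field E0 c b 2) x = pd 2 (moment_field E0 c b 1) x" if "x \<in> U" for x
    using curl_moment_field[OF U(1) E0(1) that, of c b] curl[OF that] by simp
  then show ?thesis
    using given_by_integral[OF E0(2) airy_cutoff_affine(1)[OF U E0(1) a \<epsilon>]]
      airy_cutoff_affine(2)[OF U E0(1) a \<epsilon>]
      integral_cutoff_circulation[OF U smooth_on_moment_field[OF U(1) E0(1)] smooth_on_moment_field[OF U(1) E0(1)] _ a \<epsilon>]
    by simp
qed

theorem lemma4p4:
  fixes \<Omega> :: "(real^2) set"
    and E :: "(real^2 \<Rightarrow> real^2^2) \<Rightarrow> real"
    and E0 :: "real^2 \<Rightarrow> real^2^2"
    and r \<epsilon> :: real
  assumes "open \<Omega>" and "bounded \<Omega>" and "simply_connected \<Omega>" and "0 \<in> \<Omega>"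
    and "E \<in> singular_sym_fields \<Omega>"
    and "smooth_on (\<Omega> - {0}) E0" and "given_by (\<Omega> - {0}) E E0"
    and "r > 0" and "ball 0 r \<subseteq> \<Omega>"
    and "\<epsilon> > 0" and "closure (ball 0 \<epsilon>) \<subseteq> \<Omega>"
  defines "compatible \<equiv> (\<forall>\<phi>\<in>test_functions \<Omega>. Curl_vec (Curl_tensor E) \<phi> = 0)"
    and "cond_i \<equiv> (\<forall>x\<in>\<Omega> - {0}. curl_vec (curl_tensor E0) x = 0)"
    and "cond_ii \<equiv> (\<forall>x\<in>\<Omega> - {0}. circle_integral E0 \<epsilon> x = 0)"
  shows "(compatible \<longrightarrow> cond_i \<and> cond_ii) \<and>
    (degree_of_divergence r E < -2 \<longrightarrow> (compatible \<longleftrightarrow> cond_i)) \<and>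
    (-2 \<le> degree_of_divergence r E \<and> degree_of_divergence r E < 0 \<longrightarrow>
      (compatible \<longleftrightarrow> cond_i \<and> cond_ii))"
proof -
  define U where "U = \<Omega> - {0}"
  define T where "T \<phi> = E (airy \<phi>)" for \<phi>
  define \<eta> :: "real^2 \<Rightarrow> real" where "\<eta> = cutoff (\<epsilon>\<^sup>2 / 2) (\<epsilon>\<^sup>2)"
  \<comment> \<open>These values decide whether \<open>T\<close> contains the delta distribution or its first derivatives.\<close>
  define \<tau> where "\<tau> c b = T (\<lambda>y. \<eta> y * affine_fun c b y)" for c b
  have E: "distribution_on \<Omega> E" using assms(5) by (simp add: singular_sym_fields_def)
  have T: "distribution_on \<Omega> T" unfolding T_def[abs_def] by (rule distribution_Curl_Curl[OF E])
  have U: "open U" "smooth_on U E0" "given_by U E E0" "U \<subseteq> \<Omega>"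
    using assms by (auto simp: U_def open_delete)
  have ball_\<epsilon>: "cball 0 \<epsilon> \<subseteq> \<Omega>" using assms(10,11) by simp
  then have U\<epsilon>: "cball 0 \<epsilon> - {0} \<subseteq> U" by (auto simp: U_def)
  have \<eta>: "\<eta> \<in> test_functions \<Omega>"
    unfolding \<eta>_def using ball_\<epsilon> assms(10) by (intro cutoff_test_function) simp
  have \<eta>a: "(\<lambda>y. \<eta> y * affine_fun c b y) \<in> test_functions \<Omega>" for c b
    by (intro test_functions_mult \<eta> smooth_on_affine_fun assms(1))
  have compatible: "compatible \<longleftrightarrow> (\<forall>\<phi>\<in>test_functions \<Omega>. T \<phi> = 0)"
    unfolding compatible_def T_def using Curl_Curl_eq[OF E] by simp
  have T_off: "T \<phi> = (LINT x|lborel. curl_vec (curl_tensor E0) x * \<phi> x)" if "\<phi> \<in> test_functions U" for \<phi>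
    unfolding T_def by (rule Curl_Curl_test_integral[OF U(1-3) that])
  have i_T: "T \<phi> = 0" if cond_i "\<phi> \<in> test_functions (\<Omega> - {0})" for \<phi>
  proof -
    have "curl_vec (curl_tensor E0) x * \<phi> x = 0" for x
      using that(1) not_in_supp[of x \<phi>] subsetD[OF test_functionsD(3)[OF that(2)], of x]
      by (cases "x \<in> supp \<phi>") (simp_all add: cond_i_def)
    then have "(\<lambda>x. curl_vec (curl_tensor E0) x * \<phi> x) = (\<lambda>x. 0)" by (rule ext)
    then show ?thesis using T_off[of \<phi>] that(2) by (simp add: U_def)
  qed
  have \<tau>_circulation: "\<tau> c b = cutoff_weight (\<epsilon>\<^sup>2 / 2) (\<epsilon>\<^sup>2)
      * circulation (moment_field E0 c b 1) (moment_field E0 c b 2) \<epsilon>" if cond_i for c b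
    unfolding \<tau>_def T_def \<eta>_def using that
    by (intro Curl_Curl_cutoff_affine[OF U(1) U\<epsilon> U(2,3) assms(10)]) (auto simp: cond_i_def U_def)
  have K: "cutoff_weight (\<epsilon>\<^sup>2 / 2) (\<epsilon>\<^sup>2) \<noteq> 0" using assms(10) by (intro cutoff_weight_nonzero) auto
  have circle: "circle_integral E0 \<epsilon> x = 0 \<longleftrightarrow> \<tau> (x $ 2) (- axis 2 1) = 0 \<and> \<tau> (- x $ 1) (axis 1 1) = 0"
    if cond_i for x
    using circle_integral_nth[OF U(1) U\<epsilon> U(2) assms(10), of x] \<tau>_circulation[OF that] K
    by (simp add: vec_eq_iff[of "circle_integral E0 \<epsilon> x"] forall_2)

  have compatible_i: cond_i if compatible
    unfolding cond_i_def
  proof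
    fix x assume "x \<in> \<Omega> - {0}"
    then have "x \<in> U" by (simp add: U_def)
    then show "curl_vec (curl_tensor E0) x = 0"
    proof (rule fundamental_lemma[OF U(1) smooth_on_curl_curl[OF U(1,2)]])
      fix \<phi> :: "real^2 \<Rightarrow> real" assume "\<phi> \<in> test_functions U"
      then show "(LINT y|lborel. curl_vec (curl_tensor E0) y * \<phi> y) = 0"
        using that T_off test_functions_mono[OF _ U(4)] unfolding compatible by metis
    qed
  qed
  have compatible_ii: cond_ii if compatible
    using that circle[OF compatible_i[OF that]] \<eta>a unfolding compatible \<tau>_def cond_ii_def by blast

  have \<tau>_0: "\<tau> c b = 0" if cond_i cond_ii for c b
  proof -
    have \<tau>_add: "\<tau> (s * c + t * c') (s *\<^sub>R b + t *\<^sub>R b') = s * \<tau> c b + t * \<tau> c' b'" for s t c c' b b'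
    proof -
      have "(\<lambda>y. \<eta> y * affine_fun (s * c + t * c') (s *\<^sub>R b + t *\<^sub>R b') y) =
          (\<lambda>y. s *\<^sub>R (\<eta> y * affine_fun c b y) + t *\<^sub>R (\<eta> y * affine_fun c' b' y))"
        by (simp add: affine_fun_def fun_eq_iff inner_add_left algebra_simps)
      then show ?thesis unfolding \<tau>_def using distribution_on_linear[OF T \<eta>a \<eta>a] by simp
    qed
    \<comment> \<open>Two base points on the second axis: their difference isolates the constant affine function, and
      they have first coordinate zero, so the second component gives \<open>a(y) = y\<^sub>1\<close>.\<close>
    let ?x = "\<lambda>t. (t * \<epsilon>) *\<^sub>R axis 2 1 :: real^2"
    have x: "\<tau> (t * \<epsilon>) (- axis 2 1) = 0" "\<tau> 0 (axis 1 1) = 0" if "0 < t" "t \<le> 1" for t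
    proof -
      have "norm (?x t) \<le> \<epsilon>" using that assms(10) by (simp add: abs_mult mult_left_le_one_le)
      then have "?x t \<in> \<Omega> - {0}" using that assms(10) ball_\<epsilon> by (auto simp: axis_eq_0_iff)
      then have "circle_integral E0 \<epsilon> (?x t) = 0" using \<open>cond_ii\<close> by (simp add: cond_ii_def)
      then show "\<tau> (t * \<epsilon>) (- axis 2 1) = 0" "\<tau> 0 (axis 1 1) = 0"
        unfolding circle[OF \<open>cond_i\<close>] by (simp_all add: axis_def)
    qed
    have 1: "\<tau> 1 0 = 0"
      \<comment> \<open>The value for \<open>a = \<epsilon> - y\<^sub>2\<close> minus the value for \<open>a = \<epsilon> / 2 - y\<^sub>2\<close>.\<close>
      using \<tau>_add[of "2 / \<epsilon>" "1 * \<epsilon>" "- (2 / \<epsilon>)" "1 / 2 * \<epsilon>" "- axis 2 1" "- axis 2 1"] x(1)[of 1] x(1)[of "1 / 2"] assms(10)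
      by simp
    have 2: "\<tau> 0 (axis 2 1) = 0"
      using \<tau>_add[of "- 1" "1 * \<epsilon>" "\<epsilon>" 1 "- axis 2 1" 0] x(1)[of 1] 1 by simp
    have "\<tau> 0 b = 0"
      using \<tau>_add[of "b $ 1" 0 "b $ 2" 0 "axis 1 1" "axis 2 1"] x(2)[of 1] 2 basis_expansion[of b]
      by (simp add: sum_2 scalar_mult_eq_scaleR)
    then show ?thesis using \<tau>_add[of c 1 1 0 0 b] 1 by simp
  qed

  \<comment> \<open>Already the delta distribution has scaling degree 2, which \<open>T\<close> does not reach.\<close>
  have conv_b: compatible if sd: "scaling_degree r E < ereal 0" and cond_i
  proof -
    obtain k where k: "k < 0 + 2" "\<And>\<phi>. \<phi> \<in> test_functions (ball 0 r) \<Longrightarrow>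
        ((\<lambda>l. l powr k * E (airy (rescale l \<phi>))) \<longlongrightarrow> 0) (at_right 0)"
      using scaling_degree_Curl_Curl[OF E assms(9) sd] by blast
    show ?thesis
      unfolding compatible
      using point_supported_scaling[OF assms(1) T i_T[OF \<open>cond_i\<close>] assms(8,9), of k 0] k
      by (simp add: T_def)
  qed
  \<comment> \<open>Second derivatives of the delta distribution have scaling degree 4, which \<open>T\<close> does not reach, so
    \<open>T\<close> vanishes on functions without constant and linear part at the origin.\<close>
  have conv_c: compatible if sd: "scaling_degree r E < ereal 2" and cond_i cond_ii
    unfolding compatible
  proof
    obtain k where k: "k < 2 + 2" "\<And>\<phi>. \<phi> \<in> test_functions (ball 0 r) \<Longrightarrow>
        ((\<lambda>l. l powr k * E (airy (rescale l \<phi>))) \<longlongrightarrow> 0) (at_right 0)"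
      using scaling_degree_Curl_Curl[OF E assms(9) sd] by blast
    fix \<phi> :: "real^2 \<Rightarrow> real" assume \<phi>: "\<phi> \<in> test_functions \<Omega>"
    define b :: "real^2" where "b = (\<chi> i. pd i \<phi> 0)"
    let ?a = "affine_fun (\<phi> 0) b"
    have "pds is (\<lambda>y. \<eta> y * ?a y) 0 = pds is ?a 0" for "is"
    proof (rule pds_cong_open[of "ball 0 (\<epsilon> / 2)"])
      fix y :: "real^2" assume "y \<in> ball 0 (\<epsilon> / 2)"
      then have "(norm y)\<^sup>2 \<le> (\<epsilon> / 2)\<^sup>2" by (intro power_mono) auto
      also have "\<dots> \<le> \<epsilon>\<^sup>2 / 2" by (simp add: power_divide)
      finally show "\<eta> y * ?a y = ?a y"
        using assms(10) by (simp add: \<eta>_def cutoff_eq_1 power2_norm_eq_inner)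
    qed (use assms(10) in auto)
    then have eq: "pds is (\<lambda>y. \<phi> y - \<eta> y * ?a y) 0 = pds is \<phi> 0 - pds is ?a 0" for "is"
      using pds_diff[OF test_functionsD(1)[OF \<phi>] test_functionsD(1)[OF \<eta>a], of "is"] by simp
    have "pds is (\<lambda>y. \<phi> y - \<eta> y * ?a y) 0 = 0" if "length is < 2" for "is"
    proof -
      from that consider "is = []" | i where "is = [i]"
        by (cases "is"; cases "tl is") auto
      then show ?thesis
        unfolding eq by cases (simp_all add: affine_fun_def pd_affine_fun b_def)
    qed
    then have "T (\<lambda>y. \<phi> y - \<eta> y * ?a y) = 0"
      using k by (intro point_supported_scaling[OF assms(1) T i_T[OF \<open>cond_i\<close>] assms(8,9), of k 2]
          test_functions_diff \<phi> \<eta>a) (auto simp: T_def)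
    then show "T \<phi> = 0"
      using distribution_on_diff[OF T \<phi> \<eta>a] \<tau>_0[OF \<open>cond_i\<close> \<open>cond_ii\<close>, of "\<phi> 0" b] by (simp add: \<tau>_def)
  qed

  have "scaling_degree r E < ereal 0" if "degree_of_divergence r E < - 2"
    using that unfolding degree_of_divergence_def by (cases "scaling_degree r E") auto
  moreover have "scaling_degree r E < ereal 2" if "degree_of_divergence r E < 0"
    using that unfolding degree_of_divergence_def by (cases "scaling_degree r E") auto
  ultimately show ?thesis
    using compatible_i compatible_ii conv_b conv_c by blast
qed

end
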